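(* Let $\mathbb{G}=(V,E)$ be a graph as described in the context, let $\lambda$ be the length measure on $\mathbb{G}$, and let $1\le p<\infty$. Suppose that the Borel probability measures $\mu,\nu$ on $\mathbb{G}$ are supported on the node set $V$. Then $$\hat{\mathcal{S}}_p(\mu,\nu) = \left( \sum_{e\in E} \beta_e\,\big|\mu(\gamma_e) - \nu(\gamma_e)\big|^p\right)^{1/p},$$ where for each edge $e\in E$, $$\beta_e := \begin{cases} \log\left(1 + \dfrac{w_e}{1+\lambda(\gamma_e)}\right) & \text{if } p=2,\\[2mm] \dfrac{(1+\lambda(\gamma_e)+w_e)^{2-p} - (1+\lambda(\gamma_e))^{2-p}}{2-p} & \text{otherwise.}\end{cases}$$
   Context: $\mathbb{G}=(V,E)$ is a connected, undirected graph with $V \subset \mathbb{R}^n$, where each edge $e\in E$ is the line segment in $\mathbb{R}^n$ joining its two endpoints and has positive length $w_e$. $\mathbb{G}$ is identified with the set of all nodes together with all points of all edges, with the Euclidean-induced topology, and carries the graph metric $d_{\mathbb{G}}$ (shortest-path length). There is a fixed root node $z_0\in V$ such that for every $x\in\mathbb{G}$ the shortest path $[z_0,x]$ is unique. For $x\in\mathbb{G}$ let $\Lambda(x) := \{y\in\mathbb{G} : x\in[z_0,y]\}$, and for $e\in E$ let $\gamma_e := \{y\in\mathbb{G} : e\subseteq[z_0,y]\}$. The length measure $\lambda$ on $\mathbb{G}$ is the Borel measure whose restriction to each edge is the (one-dimensional) length measure of that edge scaled so the edge has total mass $w_e$, with $\lambda(F)=\sum_{e\in E}\lambda(F\cap e)$;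 it satisfies $\lambda([x,z]) = d_{\mathbb{G}}(x,z)$ for all $x,z\in\mathbb{G}$. For $1\le q\le\infty$, a continuous $f:\mathbb{G}\to\mathbb{R}$ belongs to $W^{1,q}(\mathbb{G},\lambda)$ if there is $h\in L^q(\mathbb{G},\lambda)$ with $f(x)-f(z_0) = \int_{[z_0,x]} h\,d\lambda$ for all $x$; this $h$ is unique and denoted $f'$; $W^{1,q}_0$ consists of those $f$ with $f(z_0)=0$. The weight is $\hat w(x) := 1+\lambda(\Lambda(x))$, and $\|g\|_{L^q_{\hat w}} := (\int \hat w|g|^q\,d\lambda)^{1/q}$ ($\lambda$-essential sup of $|g|$ if $q=\infty$). With $p'$ the conjugate exponent of $p$, the regularized Sobolev IPM is $$\hat{\mathcal{S}}_p(\mu,\nu) := \sup\left\{ \left|\int f\,d\mu - \int f\,d\nu\right| : f\in W^{1,p'}_0(\mathbb{G},\lambda),\ \|f'\|_{L^{p'}_{\hat w}}\le 1\right\}.$$ *)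

theory Defs
  imports "HOL-Probability.Probability"
begin

text \<open>A metric graph embedded in a Euclidean space. Nodes are points, an (undirected)
edge is stored once as an ordered pair (u,v); the edge itself is the segment from u to v.\<close>

definition seg :: "('a::real_vector \<times> 'a) \<Rightarrow> real \<Rightarrow> 'a" where
  "seg e t = fst e + t *\<^sub>R (snd e - fst e)"

definition edge_set :: "('a::real_vector \<times> 'a) \<Rightarrow> 'a set" where
  "edge_set e = closed_segment (fst e) (snd e)"

definition gset :: "'a::real_vector set \<Rightarrow> ('a \<times> 'a) set \<Rightarrow> 'a set" where
  "gset V E = V \<union> (\<Union>e\<in>E. edge_set e)"

definition lam :: "('a::euclidean_space \<times> 'a) set \<Rightarrow> ('a \<times> 'a \<Rightarrow> real) \<Rightarrow> 'a measure" where
  "lam E w = measure_of UNIV (sets borel)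
     (\<lambda>F. \<Sum>e\<in>E. ennreal (w e) * emeasure lborel {t\<in>{0..1}. seg e t \<in> F})"

definition gdist :: "'a::euclidean_space set \<Rightarrow> ('a \<times> 'a) set \<Rightarrow> ('a \<times> 'a \<Rightarrow> real) \<Rightarrow> 'a \<Rightarrow> 'a \<Rightarrow> real" where
  "gdist V E w x y = (if x = y then 0 else
     Inf {measure (lam E w) (path_image g) | g. arc g \<and> path_image g \<subseteq> gset V E
            \<and> pathstart g = x \<and> pathfinish g = y})"

definition is_sp :: "'a::euclidean_space set \<Rightarrow> ('a \<times> 'a) set \<Rightarrow> ('a \<times> 'a \<Rightarrow> real) \<Rightarrow> 'a \<Rightarrow> 'a \<Rightarrow> 'a set \<Rightarrow> bool" where
  "is_sp V E w x y A \<longleftrightarrow> (x = y \<and> A = {x}) \<or>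
     (x \<noteq> y \<and> (\<exists>g. arc g \<and> path_image g \<subseteq> gset V E \<and> pathstart g = x \<and> pathfinish g = y
        \<and> path_image g = A \<and> measure (lam E w) A = gdist V E w x y))"

definition sp :: "'a::euclidean_space set \<Rightarrow> ('a \<times> 'a) set \<Rightarrow> ('a \<times> 'a \<Rightarrow> real) \<Rightarrow> 'a \<Rightarrow> 'a \<Rightarrow> 'a set" where
  "sp V E w x y = (THE A. is_sp V E w x y A)"

definition Lam :: "'a::euclidean_space set \<Rightarrow> ('a \<times> 'a) set \<Rightarrow> ('a \<times> 'a \<Rightarrow> real) \<Rightarrow> 'a \<Rightarrow> 'a \<Rightarrow> 'a set" where
  "Lam V E w z0 x = {y \<in> gset V E. x \<in> sp V E w z0 y}"

definition gam :: "'a::euclidean_space set \<Rightarrow> ('a \<times> 'a) set \<Rightarrow> ('a \<times> 'a \<Rightarrow> real) \<Rightarrow> 'a \<Rightarrow> ('a \<times> 'a) \<Rightarrow> 'a set" where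
  "gam V E w z0 e = {y \<in> gset V E. edge_set e \<subseteq> sp V E w z0 y}"

definition what :: "'a::euclidean_space set \<Rightarrow> ('a \<times> 'a) set \<Rightarrow> ('a \<times> 'a \<Rightarrow> real) \<Rightarrow> 'a \<Rightarrow> 'a \<Rightarrow> real" where
  "what V E w z0 x = 1 + measure (lam E w) (Lam V E w z0 x)"

definition Lq_ball :: "'a::euclidean_space set \<Rightarrow> ('a \<times> 'a) set \<Rightarrow> ('a \<times> 'a \<Rightarrow> real) \<Rightarrow> 'a \<Rightarrow> real \<Rightarrow> ('a \<Rightarrow> real) \<Rightarrow> bool" where
  "Lq_ball V E w z0 p h \<longleftrightarrow> h \<in> borel_measurable (lam E w) \<and>
     (if p = 1 then (AE x in lam E w. \<bar>h x\<bar> \<le> 1)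
      else (let q = p / (p - 1) in
              integrable (lam E w) (\<lambda>x. \<bar>h x\<bar> powr q) \<and>
              integrable (lam E w) (\<lambda>x. what V E w z0 x * \<bar>h x\<bar> powr q) \<and>
              (\<integral>x. what V E w z0 x * \<bar>h x\<bar> powr q \<partial>lam E w) powr (1 / q) \<le> 1))"

text \<open>Test functions: f \<in> W_0^{1,p'}, f(z0) = 0, with weighted norm of f' at most 1.\<close>
definition sob_feasible :: "'a::euclidean_space set \<Rightarrow> ('a \<times> 'a) set \<Rightarrow> ('a \<times> 'a \<Rightarrow> real) \<Rightarrow> 'a \<Rightarrow> real \<Rightarrow> ('a \<Rightarrow> real) \<Rightarrow> bool" where
  "sob_feasible V E w z0 p f \<longleftrightarrow> continuous_on (gset V E) f \<and> f z0 = 0 \<and>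
     (\<exists>h. Lq_ball V E w z0 p h \<and>
        (\<forall>x\<in>gset V E. set_integrable (lam E w) (sp V E w z0 x) h \<and>
             f x - f z0 = (LINT y:sp V E w z0 x|lam E w. h y)))"

definition S_hat :: "'a::euclidean_space set \<Rightarrow> ('a \<times> 'a) set \<Rightarrow> ('a \<times> 'a \<Rightarrow> real) \<Rightarrow> 'a \<Rightarrow> real \<Rightarrow> 'a measure \<Rightarrow> 'a measure \<Rightarrow> real" where
  "S_hat V E w z0 p \<mu> \<nu> = Sup {\<bar>(\<integral>x. f x \<partial>\<mu>) - (\<integral>x. f x \<partial>\<nu>)\<bar> | f. sob_feasible V E w z0 p f}"

definition beta :: "'a::euclidean_space set \<Rightarrow> ('a \<times> 'a) set \<Rightarrow> ('a \<times> 'a \<Rightarrow> real) \<Rightarrow> 'a \<Rightarrow> real \<Rightarrow> ('a \<times> 'a) \<Rightarrow> real" where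
  "beta V E w z0 p e = (let L = measure (lam E w) (gam V E w z0 e) in
     if p = 2 then ln (1 + w e / (1 + L))
     else ((1 + L + w e) powr (2 - p) - (1 + L) powr (2 - p)) / (2 - p))"

end

theory Submission
  imports Defs
begin

text \<open>
If every point has a unique shortest path to the root, the graph is a tree: on an edge that lies
on neither of the shortest paths to its ends, some interior point would be reached equally fast
from both sides. Hence each edge \<open>e\<close> joins a parent \<open>u\<close> to a child \<open>v\<close>, the weight at distance \<open>s\<close>
from \<open>v\<close> is \<open>1 + \<lambda>(\<gamma>\<^sub>e) + s\<close>, and the integral over \<open>e\<close> of its power with exponent \<open>1 - p\<close> is \<open>\<beta>\<^sub>e\<close>. Since the measures live on the nodes,
\<open>\<integral>f d\<mu> - \<integral>f d\<nu> = \<Sum>\<^sub>e (\<mu>(\<gamma>\<^sub>e) - \<nu>(\<gamma>\<^sub>e)) \<integral>\<^sub>e f'\<close>, and the supremum over the weighted unit ball is given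
by Hoelder's inequality and its equality case.
\<close>

section \<open>The length measure\<close>

text \<open>Shortest paths are given as images of injective continuous curves in the embedded set,
  not as sequences of edges, so no argument about walks or cycles applies directly. The bridge is
  topological: an arc between nodes that meets the interior of an edge contains the whole edge,
  because both halves of the arc would otherwise have to leave through the same end. After that one
  fact per edge carries the proof, its orientation \<open>down e u v\<close>; acyclicity is never
  formulated. The nodes form a null set, so the weight is computed only on open edges, where it is
  affine; this yields both its measurability and the integrals of its powers. For the upper bound,
  Young's inequality with a free scale \<open>K\<close> does the work of Hoelder's. The best scale
  is \<open>C powr (1 / p)\<close>, where \<open>C\<close> is the sum under the root, and equality
  makes \<open>h\<close> on \<open>e\<close> proportional to \<open>sgn (a e) * \<bar>a e\<bar> powr
  (p - 1) * weight x powr (1 - p)\<close>. The weight is at least 1, so this \<open>h\<close> is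
  bounded and its path integral is continuous, as membership in the Sobolev space demands.\<close>

lemma seg_swap: "seg (v, u) t = seg (u, v) (1 - t)"
  by (simp add: seg_def algebra_simps)

lemma seg_0 [simp]: "seg (u, v) 0 = u" and seg_1 [simp]: "seg (u, v) 1 = v"
  by (simp_all add: seg_def)

lemma seg_eq_iff: "u \<noteq> v \<Longrightarrow> seg (u, v) s = seg (u, v) t \<longleftrightarrow> s = t"
  by (simp add: seg_def)

lemma seg_eq_ends:
  assumes "u \<noteq> v"
  shows "seg (u, v) s = u \<longleftrightarrow> s = 0" "seg (u, v) s = v \<longleftrightarrow> s = 1"
  using seg_eq_iff[OF assms, of s 0] seg_eq_iff[OF assms, of s 1] by simp_all

lemma dist_seg:
  fixes u :: "'a::real_normed_vector"
  shows "dist (seg (u, v) s) (seg (u, v) t) = \<bar>s - t\<bar> * dist u v"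
proof -
  have "seg (u, v) s - seg (u, v) t = (s - t) *\<^sub>R (v - u)"
    by (simp add: seg_def algebra_simps)
  then show ?thesis
    by (simp add: dist_norm norm_minus_commute)
qed

lemma closed_segment_eq_seg: "closed_segment u v = seg (u, v) ` {0..1}"
  by (force simp: closed_segment_def seg_def algebra_simps)

lemma seg_seg_0: "seg (u, seg (u, v) t) s = seg (u, v) (s * t)"
  by (simp add: seg_def)

lemma closed_segment_seg: "0 \<le> t \<Longrightarrow> closed_segment u (seg (u, v) t) = seg (u, v) ` {0..t}"
proof -
  assume t: "0 \<le> t"
  have "seg (u, v) ` (\<lambda>s. s * t) ` {0..1} = seg (u, v) ` {0..t}"
  proof (cases "t = 0")
    case True
    then show ?thesis by (simp add: image_constant_conv)
  next
    case False
    have "(\<lambda>s. s * t) ` {0..1} = {0..t}"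
      using t False by (force simp: image_iff divide_simps intro!: bexI[of _ "_ / t"] mult_left_le_one_le)
    then show ?thesis by simp
  qed
  then show ?thesis
    by (simp add: closed_segment_eq_seg image_image seg_seg_0)
qed

lemma continuous_on_seg [continuous_intros]: "continuous_on S (seg (e :: 'a::real_normed_vector \<times> 'a))"
  unfolding seg_def by (intro continuous_intros)

lemma measurable_seg [measurable]: "seg (e :: 'a::euclidean_space \<times> 'a) \<in> borel_measurable borel"
  by (intro borel_measurable_continuous_onI continuous_on_seg)

lemma closed_seg_image: "closed (seg (u :: 'a::real_normed_vector \<times> 'a) ` {a..b})"
  by (intro compact_imp_closed compact_continuous_image continuous_on_seg) auto

lemma measurable_seg_preimage [measurable]:
  assumes "F \<in> sets borel"
  shows "{t \<in> {0..1}. seg (e :: 'a::euclidean_space \<times> 'a) t \<in> F} \<in> sets borel"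
proof -
  have "{t \<in> {0..1}. seg e t \<in> F} = seg e -` F \<inter> space borel \<inter> {0..1}"
    by auto
  then show ?thesis
    using measurable_sets[OF measurable_seg assms, of e] by simp
qed

section \<open>The length measure and integration edge by edge\<close>

lemma sets_lam [simp, measurable_cong]: "sets (lam E w) = sets borel"
  using sigma_algebra.sets_measure_of_eq[OF sets.sigma_algebra_axioms, of borel]
  by (simp add: lam_def)

lemma space_lam [simp]: "space (lam E w) = UNIV"
  by (simp add: lam_def space_measure_of_conv)

text \<open>\<open>measure_of\<close> yields the given set function only once countable additivity
  is known. It is inherited from Lebesgue measure edge by edge, since preimages of disjoint sets
  under \<open>seg e\<close> are disjoint.\<close>

lemma emeasure_lam:
  assumes "finite E" and F: "F \<in> sets borel"
  shows "emeasure (lam E w) F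
    = (\<Sum>e\<in>E. ennreal (w e) * emeasure lborel {t\<in>{0..1}. seg e t \<in> F})"
proof -
  have "countably_additive (sets borel)
    (\<lambda>F. \<Sum>e\<in>E. ennreal (w e) * emeasure lborel {t\<in>{0..1}. seg e t \<in> F})"
  proof (rule countably_additiveI)
    fix A :: "nat \<Rightarrow> 'a set"
    assume A: "range A \<subseteq> sets borel" "disjoint_family A" "(\<Union>i. A i) \<in> sets borel"
    have "(\<Sum>i. emeasure lborel {t\<in>{0..1}. seg e t \<in> A i})
        = emeasure lborel {t\<in>{0..1}. seg e t \<in> (\<Union>i. A i)}" for e :: "'a \<times> 'a"
    proof -
      have "range (\<lambda>i. {t\<in>{0..1}. seg e t \<in> A i}) \<subseteq> sets lborel"
        using A(1) measurable_seg_preimage by (auto simp del: mem_Collect_eq)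
      moreover have "disjoint_family (\<lambda>i. {t\<in>{0..1}. seg e t \<in> A i})"
        using A(2) by (auto simp: disjoint_family_on_def)
      ultimately have "(\<Sum>i. emeasure lborel {t\<in>{0..1}. seg e t \<in> A i})
          = emeasure lborel (\<Union>i. {t\<in>{0..1}. seg e t \<in> A i})"
        by (rule suminf_emeasure)
      also have "(\<Union>i. {t\<in>{0..1}. seg e t \<in> A i}) = {t\<in>{0..1}. seg e t \<in> (\<Union>i. A i)}"
        by auto
      finally show ?thesis .
    qed
    then show "(\<Sum>i. \<Sum>e\<in>E. ennreal (w e) * emeasure lborel {t\<in>{0..1}. seg e t \<in> A i})
        = (\<Sum>e\<in>E. ennreal (w e) * emeasure lborel {t\<in>{0..1}. seg e t \<in> (\<Union>i. A i)})"
      by (subst suminf_sum) auto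
  qed
  moreover have "positive (sets borel)
    (\<lambda>F. \<Sum>e\<in>E. ennreal (w e) * emeasure lborel {t\<in>{0..1}. seg e t \<in> F})"
    by (simp add: positive_def)
  ultimately show ?thesis
    unfolding lam_def using F
    by (intro emeasure_measure_of_sigma) (use sets.sigma_algebra_axioms[of borel] in simp_all)
qed

lemma finite_measure_lam:
  assumes "finite E"
  shows "finite_measure (lam E w)"
proof
  have "emeasure lborel {t\<in>{0..1::real}. seg e t \<in> UNIV} = 1" for e :: "'a \<times> 'a"
    using emeasure_lborel_Icc[of 0 "1::real"] by (simp add: atLeastAtMost_iff[symmetric] del: atLeastAtMost_iff)
  then show "emeasure (lam E w) (space (lam E w)) \<noteq> \<infinity>"
    using assms by (simp add: emeasure_lam)
qed

lemma nn_integral_lam: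
  fixes f :: "'a::euclidean_space \<Rightarrow> ennreal"
  assumes fin: "finite E" and "f \<in> borel_measurable borel"
  shows "(\<integral>\<^sup>+x. f x \<partial>lam E w) = (\<Sum>e\<in>E. ennreal (w e) * (\<integral>\<^sup>+t. f (seg e t) * indicator {0..1} t \<partial>lborel))"
  using assms(2)
proof (induction rule: borel_measurable_induct)
  case (cong f g)
  then have "f = g" by auto
  with cong show ?case by simp
next
  case (set A)
  have "(\<integral>\<^sup>+t. indicator A (seg e t) * indicator {0..1} t \<partial>lborel)
      = emeasure lborel {t\<in>{0..1}. seg e t \<in> A}" for e :: "'a \<times> 'a"
  proof -
    have "indicator A (seg e t) * indicator {0..1} t = (indicator {t\<in>{0..1}. seg e t \<in> A} t :: ennreal)" for t
      by (auto simp: indicator_def)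
    then show ?thesis using set by simp
  qed
  then show ?case using set fin by (simp add: emeasure_lam)
next
  case (mult u c)
  have "u \<in> borel_measurable (lam E w)" using mult by simp
  with mult show ?case
    by (simp add: nn_integral_cmult sum_distrib_left mult.assoc mult.left_commute[of _ c])
next
  case (add u v)
  have "u \<in> borel_measurable (lam E w)" "v \<in> borel_measurable (lam E w)" using add by simp_all
  with add show ?case
    by (simp add: nn_integral_add distrib_right distrib_left sum.distrib)
next
  case (seq U)
  have m: "U i \<in> borel_measurable (lam E w)" for i using seq by simp
  have "(\<integral>\<^sup>+x. (SUP i. U i) x \<partial>lam E w) = (SUP i. \<integral>\<^sup>+x. U i x \<partial>lam E w)"
    using nn_integral_monotone_convergence_SUP[of U "lam E w"] seq m by (simp add: image_comp)
  also have "\<dots> = (SUP i. \<Sum>e\<in>E. ennreal (w e) * (\<integral>\<^sup>+t. U i (seg e t) * indicator {0..1} t \<partial>lborel))"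
    using seq by simp
  also have "\<dots> = (\<Sum>e\<in>E. SUP i. ennreal (w e) * (\<integral>\<^sup>+t. U i (seg e t) * indicator {0..1} t \<partial>lborel))"
    using seq(3) by (intro ennreal_SUP_sum)
      (auto simp: incseq_def le_fun_def intro!: mult_left_mono nn_integral_mono mult_right_mono)
  also have "\<dots> = (\<Sum>e\<in>E. ennreal (w e) * (\<integral>\<^sup>+t. (SUP i. U i) (seg e t) * indicator {0..1} t \<partial>lborel))"
  proof (intro sum.cong refl)
    fix e
    have "(SUP i. \<integral>\<^sup>+t. U i (seg e t) * indicator {0..1} t \<partial>lborel)
        = (\<integral>\<^sup>+t. (SUP i. U i (seg e t) * indicator {0..1} t) \<partial>lborel)"
      using seq by (intro nn_integral_monotone_convergence_SUP[symmetric])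
       (auto simp: incseq_def le_fun_def intro!: mult_right_mono)
    then show "(SUP i. ennreal (w e) * (\<integral>\<^sup>+t. U i (seg e t) * indicator {0..1} t \<partial>lborel))
       = ennreal (w e) * (\<integral>\<^sup>+t. (SUP i. U i) (seg e t) * indicator {0..1} t \<partial>lborel)"
      by (simp add: SUP_mult_left_ennreal[symmetric] SUP_mult_right_ennreal[symmetric] image_comp)
  qed
  finally show ?case .
qed

text \<open>Invariance under the reflection of the unit interval. The stored order of the ends of an
  edge is arbitrary, while later arguments run along the edge away from the root.\<close>

lemma nn_integral_seg_swap:
  fixes f :: "'a::euclidean_space \<Rightarrow> ennreal"
  assumes [measurable]: "f \<in> borel_measurable borel"
  shows "(\<integral>\<^sup>+t. f (seg (v, u) t) * indicator {0..1} t \<partial>lborel)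
       = (\<integral>\<^sup>+t. f (seg (u, v) t) * indicator {0..1} t \<partial>lborel)"
proof -
  have "(\<integral>\<^sup>+t. f (seg (u, v) t) * indicator {0..1} t \<partial>lborel)
     = ennreal \<bar>-1\<bar> * (\<integral>\<^sup>+t. f (seg (u, v) (1 + (-1) * t)) * indicator {0..1} (1 + (-1) * t) \<partial>lborel)"
    by (subst nn_integral_real_affine[where c="-1" and t=1]) auto
  also have "\<dots> = (\<integral>\<^sup>+t. f (seg (v, u) t) * indicator {0..1} t \<partial>lborel)"
    by (auto simp: seg_swap[of v u] indicator_def intro!: nn_integral_cong)
  finally show ?thesis by simp
qed

section \<open>Arcs in an embedded graph\<close>

locale metric_graph =
  fixes V :: "'a::euclidean_space set" and E :: "('a \<times> 'a) set" and w :: "'a \<times> 'a \<Rightarrow> real"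
  assumes finite_nodes: "finite V"
    and E_sub: "E \<subseteq> V \<times> V"
    and E_loopfree: "\<forall>e\<in>E. fst e \<noteq> snd e"
    and w_pos: "\<forall>e\<in>E. w e > 0"
    and embed_nodes: "\<forall>e\<in>E. edge_set e \<inter> V = {fst e, snd e}"
    and embed_edges: "\<forall>e1\<in>E. \<forall>e2\<in>E. e1 \<noteq> e2 \<longrightarrow> edge_set e1 \<inter> edge_set e2 \<subseteq> V"
begin

abbreviation "G \<equiv> gset V E"
abbreviation "\<Lambda> \<equiv> lam E w"

text \<open>Hides the arbitrary order in which an edge is stored, so that a statement about one end
  can be reused for the other through \<open>joins_sym\<close>.\<close>

definition joins :: "'a \<times> 'a \<Rightarrow> 'a \<Rightarrow> 'a \<Rightarrow> bool" where
  "joins e u v \<longleftrightarrow> e \<in> E \<and> (e = (u, v) \<or> e = (v, u))"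

text \<open>Subtracting all of \<open>V\<close> removes exactly the two ends, by
  \<open>embed_nodes\<close>. The open edges are pairwise disjoint and, together with
  \<open>V\<close>, partition the graph.\<close>

definition edge_int :: "'a \<times> 'a \<Rightarrow> 'a set" where
  "edge_int e = edge_set e - V"

text \<open>Unlike \<^const>\<open>arc\<close>, the trivial arc from a point to itself is included.\<close>
definition arcset :: "'a \<Rightarrow> 'a \<Rightarrow> 'a set \<Rightarrow> bool" where
  "arcset a b A \<longleftrightarrow> (a = b \<and> a \<in> G \<and> A = {a}) \<or>
     (a \<noteq> b \<and> (\<exists>g. arc g \<and> path_image g \<subseteq> G \<and> pathstart g = a \<and> pathfinish g = b \<and> path_image g = A))"

lemma finite_edges: "finite E"
  using finite_subset[OF E_sub] finite_nodes by simp

lemma joins_sym: "joins e u v \<Longrightarrow> joins e v u"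
  by (auto simp: joins_def)

lemma joins_ex: "e \<in> E \<Longrightarrow> \<exists>u v. joins e u v"
  by (metis joins_def prod.exhaust)

lemma joinsD:
  assumes "joins e u v"
  shows "e \<in> E" "u \<noteq> v" "u \<in> V" "v \<in> V"
    and "edge_set e = seg (u, v) ` {0..1}" "edge_set e \<inter> V = {u, v}" "edge_set e \<subseteq> G"
proof -
  show "e \<in> E" "u \<noteq> v" "u \<in> V" "v \<in> V"
    using assms E_sub E_loopfree by (auto simp: joins_def)
  show "edge_set e = seg (u, v) ` {0..1}"
    using assms by (auto simp: joins_def edge_set_def closed_segment_eq_seg[symmetric] closed_segment_commute)
  show "edge_set e \<inter> V = {u, v}"
    using assms embed_nodes by (auto simp: joins_def)
  show "edge_set e \<subseteq> G"
    using \<open>e \<in> E\<close> by (auto simp: gset_def)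
qed

lemma joins_seg_eq_iff: "joins e u v \<Longrightarrow> seg (u, v) s = seg (u, v) t \<longleftrightarrow> s = t"
  using seg_eq_iff joinsD(2) by metis

lemma joins_seg_in_V_iff:
  assumes "joins e u v" "0 \<le> t" "t \<le> 1"
  shows "seg (u, v) t \<in> V \<longleftrightarrow> t = 0 \<or> t = 1"
proof -
  have "seg (u, v) t \<in> edge_set e"
    using assms joinsD(5) by auto
  then have "seg (u, v) t \<in> V \<longleftrightarrow> seg (u, v) t = u \<or> seg (u, v) t = v"
    using joinsD(6)[OF assms(1)] by auto
  then show ?thesis
    using seg_eq_ends[OF joinsD(2)[OF assms(1)]] by simp
qed

lemma edge_int_eq:
  assumes "joins e u v"
  shows "edge_int e = seg (u, v) ` {0<..<1}"
  unfolding edge_int_def joinsD(5)[OF assms]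
  using joins_seg_in_V_iff[OF assms] by (auto simp: less_le)

lemma edge_intE:
  assumes "joins e u v" "y \<in> edge_int e"
  obtains t where "0 < t" "t < 1" "y = seg (u, v) t"
  using assms edge_int_eq by auto

lemma edge_set_eq: "joins e u v \<Longrightarrow> edge_set e = insert u (insert v (edge_int e))"
  using joinsD(6)[of e u v] by (auto simp: edge_int_def)

lemma edge_int_disjoint:
  assumes "e \<in> E" "e' \<in> E" "e \<noteq> e'"
  shows "edge_int e \<inter> edge_set e' = {}"
  using assms embed_edges by (auto simp: edge_int_def)

lemma edge_int_disjoint_V: "edge_int e \<inter> V = {}"
  by (auto simp: edge_int_def)

lemma edge_int_subset: "edge_int e \<subseteq> edge_set e"
  by (auto simp: edge_int_def)

lemma edge_int_nonempty: "e \<in> E \<Longrightarrow> edge_int e \<noteq> {}"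
  using joins_ex edge_int_eq by fastforce

lemma edge_set_subset_G: "e \<in> E \<Longrightarrow> edge_set e \<subseteq> G"
  using joins_ex joinsD(7) by blast

lemma V_subset_G: "V \<subseteq> G"
  by (auto simp: gset_def)

lemma G_eq: "G = V \<union> (\<Union>e\<in>E. edge_int e)"
  by (auto simp: gset_def edge_int_def)

lemma closed_edge_set [simp]: "closed (edge_set (e :: 'a \<times> 'a))"
  by (simp add: edge_set_def)

lemma compact_G: "compact G"
  using finite_nodes finite_edges unfolding gset_def
  by (intro compact_Un compact_UN) (auto simp: finite_imp_compact edge_set_def)

text \<open>The reason is that an open subsegment of an edge is open in the graph.\<close>
lemma connected_leaves_subsegment:
  assumes e: "joins e u v" and C: "connected C" "C \<subseteq> G" and ab: "0 \<le> a" "b \<le> 1"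
    and s: "a < s" "s < b" "seg (u, v) s \<in> C" and x: "x \<in> C" "x \<notin> seg (u, v) ` {a<..<b}"
  shows "seg (u, v) a \<in> C \<or> seg (u, v) b \<in> C"
proof (rule ccontr)
  assume ends: "\<not> ?thesis"
  define S where "S = seg (u, v) ` {a<..<b}"
  define T where "T = seg (u, v) ` {a..b}"
  \<comment> \<open>\<open>K\<close> is a closed set that contains the graph outside the open
    subsegment \<open>S\<close>, and \<open>T\<close> is the closed subsegment. If \<open>C\<close>
    avoids both ends of \<open>T\<close>, then \<open>T\<close> and \<open>K\<close> separate
    \<open>C\<close>.\<close>
  define K where "K = V \<union> (\<Union>e'\<in>E - {e}. edge_set e') \<union> seg (u, v) ` {0..a} \<union> seg (u, v) ` {b..1}"
  have "closed K"
    unfolding K_def using finite_nodes finite_edges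
    by (intro closed_Un closed_UN) (auto simp: finite_imp_closed closed_seg_image)
  moreover have "closed T"
    unfolding T_def by (rule closed_seg_image)
  moreover have "G \<subseteq> S \<union> K"
  proof
    fix y assume "y \<in> G"
    then consider "y \<in> V" | e' where "e' \<in> E" "e' \<noteq> e" "y \<in> edge_set e'" | "y \<in> edge_set e"
      by (auto simp: gset_def)
    then show "y \<in> S \<union> K"
    proof cases
      case 3
      then obtain t where "0 \<le> t" "t \<le> 1" "y = seg (u, v) t"
        using joinsD(5)[OF e] by auto
      then show ?thesis unfolding S_def K_def
        by (cases "t \<le> a"; cases "b \<le> t") auto
    qed (auto simp: K_def)
  qed
  then have "C \<subseteq> T \<union> K"
    using C(2) by (auto simp: S_def T_def)
  moreover have "S \<inter> K = {}"
  proof -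
    have "seg (u, v) t \<notin> K" if t: "a < t" "t < b" for t
    proof -
      have "seg (u, v) t \<in> edge_int e"
        using t ab unfolding edge_int_eq[OF e] by auto
      then have "seg (u, v) t \<notin> V" "seg (u, v) t \<notin> (\<Union>e'\<in>E - {e}. edge_set e')"
        using edge_int_disjoint[OF joinsD(1)[OF e]] edge_int_disjoint_V by blast+
      then show ?thesis
        using t by (auto simp: K_def joins_seg_eq_iff[OF e])
    qed
    then show ?thesis by (auto simp: S_def)
  qed
  moreover have "C \<inter> T \<subseteq> S"
  proof
    fix y assume "y \<in> C \<inter> T"
    then obtain t where "a \<le> t" "t \<le> b" "y = seg (u, v) t" "y \<in> C"
      by (auto simp: T_def)
    then show "y \<in> S"
      using ends by (cases "t = a"; cases "t = b") (auto simp: S_def)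
  qed
  ultimately have "T \<inter> C = {} \<or> K \<inter> C = {}"
    by (intro connected_closedD[OF C(1)]) auto
  moreover have "seg (u, v) s \<in> T \<inter> C"
    using s by (auto simp: T_def)
  moreover have "x \<in> K \<inter> C"
    using x C(2) \<open>G \<subseteq> S \<union> K\<close> by (auto simp: S_def)
  ultimately show False by blast
qed

section \<open>Cutting and joining arcs, and how they traverse edges\<close>

lemma arcset_subset: "arcset a b A \<Longrightarrow> A \<subseteq> G"
  by (auto simp: arcset_def)

lemma arcset_ends: "arcset a b A \<Longrightarrow> a \<in> A" "arcset a b A \<Longrightarrow> b \<in> A"
  unfolding arcset_def using pathstart_in_path_image pathfinish_in_path_image by blast+

lemma connected_arcset: "arcset a b A \<Longrightarrow> connected A"
  unfolding arcset_def using connected_arc_image by auto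

lemma compact_arcset: "arcset a b A \<Longrightarrow> compact A"
  unfolding arcset_def using compact_arc_image by auto

lemma borel_arcset [measurable]: "arcset a b A \<Longrightarrow> A \<in> sets borel"
  using compact_arcset compact_imp_closed borel_closed by blast

text \<open>The two pieces meet only in \<open>y\<close> because the parametrization is injective.
  Admitting trivial arcs is what allows \<open>y\<close> to be an end of \<open>A\<close>.\<close>

lemma arcset_cut:
  assumes A: "arcset a b A" and y: "y \<in> A"
  obtains P Q where "arcset a y P" "arcset y b Q" "P \<union> Q = A" "P \<inter> Q = {y}"
proof (cases "a = b")
  case True
  then show ?thesis using that[of A A] A y by (auto simp: arcset_def)
next
  case False
  then obtain g where g: "arc g" "path_image g \<subseteq> G" "pathstart g = a" "pathfinish g = b" "path_image g = A"
    using A by (auto simp: arcset_def)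
  obtain t where t: "t \<in> {0..1}" "y = g t"
    using y g by (auto simp: path_image_def)
  have inj: "inj_on g {0..1}" and g01: "g 0 = a" "g 1 = b"
    using g by (auto simp: arc_def pathstart_def pathfinish_def)
  have "arcset (g r) (g s) (g ` {r..s})" if "0 \<le> r" "r \<le> s" "s \<le> 1" for r s
  proof (cases "r = s")
    case True
    moreover have "g s \<in> G"
      using that g(2) by (auto simp: path_image_def)
    ultimately show ?thesis by (auto simp: arcset_def)
  next
    case False
    have "g r \<noteq> g s"
      using False that inj by (auto simp: inj_on_def)
    moreover have "arc (subpath r s g)"
      using that \<open>g r \<noteq> g s\<close> g(1) by (intro arc_subpath_arc) auto
    moreover have "path_image (subpath r s g) = g ` {r..s}"
      using that by (simp add: path_image_subpath)
    moreover have "g ` {r..s} \<subseteq> G"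
      using that g(2) by (auto simp: path_image_def)
    ultimately show ?thesis
      unfolding arcset_def by (metis pathstart_subpath pathfinish_subpath)
  qed
  from this[of 0 t] this[of t 1] have "arcset a y (g ` {0..t})" "arcset y b (g ` {t..1})"
    using t g01 by simp_all
  moreover have "g ` {0..t} \<union> g ` {t..1} = A"
  proof -
    have "{0..1} = {0..t} \<union> {t..1}" using t by auto
    then show ?thesis using g(5) by (metis image_Un path_image_def)
  qed
  moreover have "g ` {0..t} \<inter> g ` {t..1} = g ` ({0..t} \<inter> {t..1})"
    using t by (intro inj_on_image_Int[OF inj, symmetric]) auto
  then have "g ` {0..t} \<inter> g ` {t..1} = {y}"
    using t by simp
  ultimately show ?thesis using that by blast
qed

lemma arcset_concat:
  assumes P: "arcset a b P" and Q: "arcset b c Q" and PQ: "P \<inter> Q = {b}"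
  shows "arcset a c (P \<union> Q)"
proof (cases "a = b \<or> b = c")
  case True
  then show ?thesis
    using P Q arcset_ends[OF P] arcset_ends[OF Q] by (auto simp: arcset_def insert_absorb)
next
  case False
  then obtain f g where f: "arc f" "path_image f \<subseteq> G" "pathstart f = a" "pathfinish f = b" "path_image f = P"
    and g: "arc g" "path_image g \<subseteq> G" "pathstart g = b" "pathfinish g = c" "path_image g = Q"
    using P Q by (auto simp: arcset_def)
  have "arc (f +++ g)"
    using f g PQ by (intro arc_join) auto
  moreover have "path_image (f +++ g) = P \<union> Q"
    using f g by (simp add: path_image_join)
  moreover have "a \<noteq> c"
    using arcset_ends(1)[OF P] arcset_ends(2)[OF Q] PQ False by blast
  ultimately show ?thesis
    unfolding arcset_def using f g by (metis Un_least pathstart_join pathfinish_join)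
qed

lemma arcset_segment:
  assumes e: "joins e u v" and t: "0 \<le> t" "t \<le> 1"
  shows "arcset u (seg (u, v) t) (seg (u, v) ` {0..t})"
proof (cases "t = 0")
  case True
  then show ?thesis using joinsD(3)[OF e] V_subset_G by (auto simp: arcset_def)
next
  case False
  then have "u \<noteq> seg (u, v) t"
    using joins_seg_eq_iff[OF e, of 0 t] by simp
  moreover have "seg (u, v) ` {0..t} \<subseteq> G"
    using joinsD(5,7)[OF e] t by force
  ultimately show ?thesis unfolding arcset_def
    using closed_segment_seg[OF t(1), of u v] arc_linepath[of u "seg (u, v) t"]
    by (metis path_image_linepath pathstart_linepath pathfinish_linepath)
qed

text \<open>Suppose \<open>A\<close> contains the interior point \<open>x\<close> but misses
  \<open>y\<close> on the same edge. Cut \<open>A\<close> at \<open>x\<close>: each half runs from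
  \<open>x\<close> to a node and cannot pass \<open>y\<close>, so it contains the end
  \<open>u\<close> on the other side of \<open>x\<close>. But the halves share only
  \<open>x\<close>.\<close>

lemma node_arcset_interior:
  assumes ab: "a \<in> V" "b \<in> V" and A: "arcset a b A" and e: "e \<in> E" and meets: "A \<inter> edge_int e \<noteq> {}"
  shows "edge_set e \<subseteq> A"
proof (rule ccontr)
  assume "\<not> edge_set e \<subseteq> A"
  then obtain y where y: "y \<in> edge_set e" "y \<notin> A" by blast
  obtain x where x: "x \<in> A" "x \<in> edge_int e" using meets by blast
  have False if uv: "joins e u v" and s: "0 < s" "s < r" "r \<le> 1" and xs: "x = seg (u, v) s" and yr: "y = seg (u, v) r"
    for u v s r
  proof -
    have uC: "u \<in> C" if C: "arcset c d C" "C \<subseteq> A" "x \<in> C" "c' \<in> C" "c' \<in> V" for c d c' C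
    proof -
      have "c' \<notin> seg (u, v) ` {0<..<r}"
        using that(5) s edge_int_eq[OF uv] edge_int_disjoint_V by fastforce
      then have "seg (u, v) 0 \<in> C \<or> seg (u, v) r \<in> C"
        using connected_leaves_subsegment[OF uv connected_arcset[OF C(1)] arcset_subset[OF C(1)], of 0 r s c'] C s xs
        by simp
      then show ?thesis using C(2) y(2) yr by auto
    qed
    obtain P Q where PQ: "arcset a x P" "arcset x b Q" "P \<union> Q = A" "P \<inter> Q = {x}"
      using arcset_cut[OF A x(1)] .
    have "u \<in> P"
      using uC[OF PQ(1), of a] PQ(3) arcset_ends[OF PQ(1)] ab by blast
    moreover have "u \<in> Q"
      using uC[OF PQ(2), of b] PQ(3) arcset_ends[OF PQ(2)] ab by blast
    ultimately have "u = x"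
      using PQ(4) by auto
    then show False
      using x(2) joinsD(3)[OF uv] by (simp add: edge_int_def)
  qed
  note * = this
  obtain u v where uv: "joins e u v" using joins_ex[OF e] by blast
  obtain s where s: "0 < s" "s < 1" "x = seg (u, v) s" using x(2) edge_int_eq[OF uv] by auto
  obtain r where r: "0 \<le> r" "r \<le> 1" "y = seg (u, v) r" using y(1) joinsD(5)[OF uv] by auto
  have "r \<noteq> s" using s r x y by auto
  then consider "s < r" | "r < s" by linarith
  then show False
  proof cases
    case 1
    then show ?thesis using *[OF uv] s r by blast
  next
    case 2
    then show ?thesis using *[OF joins_sym[OF uv], of "1 - s" "1 - r"] s r
      by (simp add: seg_swap[of v u])
  qed
qed

text \<open>The arc must finally enter the edge through one of its ends and then run straight to
  \<open>x\<close>. Inclusion in \<open>A\<close> is enough, as only lower bounds on length are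
  drawn from it.\<close>

lemma arcset_to_interior:
  assumes a: "a \<in> V" and A: "arcset a x A" and e: "joins e u v" and x: "x = seg (u, v) s" "0 < s" "s < 1"
  shows "(\<exists>P. arcset a u P \<and> P \<union> seg (u, v) ` {0..s} \<subseteq> A \<and> P \<inter> seg (u, v) ` {0..s} = {u})
       \<or> (\<exists>P. arcset a v P \<and> P \<union> seg (u, v) ` {s..1} \<subseteq> A \<and> P \<inter> seg (u, v) ` {s..1} = {v})"
proof -
  \<comment> \<open>With a gap on both sides of \<open>x\<close>, the arc would be confined to the
    subsegment between the gaps and could not reach the node \<open>c\<close>.\<close>
  have covers: "seg (u, v) ` {0..s} \<subseteq> C \<or> seg (u, v) ` {s..1} \<subseteq> C" if "arcset c x C" "c \<in> V" for c C
  proof (rule ccontr)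
    assume "\<not> ?thesis"
    then obtain r r' where r: "0 \<le> r" "r \<le> s" "seg (u, v) r \<notin> C" and r': "s \<le> r'" "r' \<le> 1" "seg (u, v) r' \<notin> C"
      unfolding image_subset_iff by (auto simp: Ball_def)
    have "seg (u, v) s \<in> C"
      using arcset_ends that x by blast
    with r r' have "r < s" "s < r'"
      by (metis order_le_less)+
    moreover have "c \<notin> seg (u, v) ` {r<..<r'}"
      using that(2) r r' edge_int_eq[OF e] edge_int_disjoint_V by fastforce
    ultimately show False
      using connected_leaves_subsegment[OF e connected_arcset[OF that(1)] arcset_subset[OF that(1)], of r r' s c]
        arcset_ends[OF that(1)] r r' x by blast
  qed
  have u_mem: "u \<in> seg (u, v) ` {0..s}" and v_mem: "v \<in> seg (u, v) ` {s..1}"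
    using x by (auto intro!: image_eqI[of u _ 0] image_eqI[of v _ 1])
  have *: ?thesis if ends: "(u = u' \<and> v = v' \<and> S = seg (u, v) ` {0..s} \<and> T = seg (u, v) ` {s..1}) \<or>
      (u = v' \<and> v = u' \<and> T = seg (u, v) ` {0..s} \<and> S = seg (u, v) ` {s..1})" and u'A: "u' \<in> A" for u' v' S T
  proof -
    have u'v': "u' \<in> S" "v' \<in> T" "u' \<in> V" "v' \<in> V"
      using ends u_mem v_mem joinsD[OF e] by auto
    obtain P Q where PQ: "arcset a u' P" "arcset u' x Q" "P \<union> Q = A" "P \<inter> Q = {u'}"
      using arcset_cut[OF A u'A] .
    show ?thesis
    proof (cases "v' \<in> Q")
      case False
      then have "S \<subseteq> Q"
        using covers[OF PQ(2) u'v'(3)] ends u'v'(2) by blast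
      then have "P \<union> S \<subseteq> A" "P \<inter> S = {u'}"
        using PQ u'v' by blast+
      then show ?thesis using PQ(1) ends by blast
    next
      case True
      \<comment> \<open>If the arc visits both ends, it is cut again at the later one
        \<open>v'\<close>. The last piece avoids \<open>u'\<close> by injectivity, hence it must
        cover the side of \<open>v'\<close>.\<close>
      obtain Q1 Q2 where Q12: "arcset u' v' Q1" "arcset v' x Q2" "Q1 \<union> Q2 = Q" "Q1 \<inter> Q2 = {v'}"
        using arcset_cut[OF PQ(2) True] .
      have "u' \<noteq> v'" using ends joinsD(2)[OF e] by auto
      then have u': "u' \<in> Q1" "u' \<notin> Q2"
        using arcset_ends[OF Q12(1)] Q12(4) by auto
      then have "T \<subseteq> Q2"
        using covers[OF Q12(2) u'v'(4)] ends u'v'(1) by blast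
      moreover have "arcset a v' (P \<union> Q1)"
        using PQ Q12 u' by (intro arcset_concat[OF PQ(1) Q12(1)]) auto
      moreover have "(P \<union> Q1) \<inter> Q2 = {v'}"
        using PQ Q12 u' by auto
      ultimately have "P \<union> Q1 \<union> T \<subseteq> A" "(P \<union> Q1) \<inter> T = {v'}" "arcset a v' (P \<union> Q1)"
        using PQ Q12 u'v' by blast+
      then show ?thesis using ends by blast
    qed
  qed
  consider "u \<in> A" | "v \<in> A"
    using covers[OF A a] u_mem v_mem by blast
  then show ?thesis
  proof cases
    case 1
    then show ?thesis using *[of u v "seg (u, v) ` {0..s}" "seg (u, v) ` {s..1}"] by simp
  next
    case 2
    then show ?thesis using *[of v u "seg (u, v) ` {s..1}" "seg (u, v) ` {0..s}"] by simp
  qed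
qed

text \<open>The sum over all edges collapses to one term: another edge can meet \<open>e\<close>
  only at its own parameters 0 and 1, which form a null set.\<close>

lemma nn_integral_edge:
  fixes f :: "'a \<Rightarrow> ennreal"
  assumes e: "joins e u v" and f [measurable]: "f \<in> borel_measurable borel"
  shows "(\<integral>\<^sup>+x. f x * indicator (edge_set e) x \<partial>\<Lambda>)
       = ennreal (w e) * (\<integral>\<^sup>+t. f (seg (u, v) t) * indicator {0..1} t \<partial>lborel)"
proof -
  have "edge_set e \<in> sets borel" by simp
  note [measurable] = this
  define T where "T e' = (\<integral>\<^sup>+t. f (seg e' t) * indicator (edge_set e) (seg e' t) * indicator {0..1} t \<partial>lborel)" for e'
  have "T e' = 0" if e': "e' \<in> E" "e' \<noteq> e" for e'
  proof -
    obtain a b where ab: "e' = (a, b)" by fastforce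
    have j: "joins e' a b" using e' ab by (auto simp: joins_def)
    have "seg e' t \<notin> edge_set e" if "0 \<le> t" "t \<le> 1" "t \<noteq> 0" "t \<noteq> 1" for t
    proof -
      have "seg e' t \<in> edge_int e'"
        using that edge_int_eq[OF j] ab by auto
      then show ?thesis
        using edge_int_disjoint[OF e'(1) joinsD(1)[OF e] e'(2)] by blast
    qed
    moreover have "AE t in lborel. t \<notin> {0, 1::real}"
      by (intro AE_not_in countable_imp_null_set_lborel) auto
    ultimately have "AE t in lborel. f (seg e' t) * indicator (edge_set e) (seg e' t) * indicator {0..1} t = 0"
      by (elim eventually_mono) (auto simp: indicator_def)
    then show ?thesis
      unfolding T_def by (subst nn_integral_0_iff_AE) auto
  qed
  then have "(\<Sum>e'\<in>E. ennreal (w e') * T e') = ennreal (w e) * T e"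
    using finite_edges joinsD(1)[OF e] by (subst sum.remove[of E e]) auto
  moreover have "T e = (\<integral>\<^sup>+t. f (seg e t) * indicator {0..1} t \<partial>lborel)"
    unfolding T_def using joinsD(5)[OF e] joinsD(5)[OF joins_sym[OF e]] e
    by (intro nn_integral_cong) (auto simp: indicator_def joins_def)
  moreover have "\<dots> = (\<integral>\<^sup>+t. f (seg (u, v) t) * indicator {0..1} t \<partial>lborel)"
    using e nn_integral_seg_swap[OF f, of v u] by (auto simp: joins_def)
  ultimately show ?thesis
    using finite_edges by (simp add: nn_integral_lam T_def)
qed

section \<open>Lengths of segments and null sets\<close>

sublocale length_measure: finite_measure \<Lambda>
  using finite_edges by (rule finite_measure_lam)

lemma measure_segment:
  assumes e: "joins e u v" and ab: "0 \<le> a" "a \<le> b" "b \<le> 1"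
  shows "measure \<Lambda> (seg (u, v) ` {a..b}) = w e * (b - a)"
proof -
  have [measurable]: "seg (u, v) ` {a..b} \<in> sets borel"
    using closed_seg_image by (rule borel_closed)
  have "seg (u, v) ` {a..b} \<subseteq> edge_set e"
    using joinsD(5)[OF e] ab by auto
  then have "emeasure \<Lambda> (seg (u, v) ` {a..b})
      = (\<integral>\<^sup>+x. indicator (seg (u, v) ` {a..b}) x * indicator (edge_set e) x \<partial>\<Lambda>)"
    by (simp add: indicator_inter_arith[symmetric] Int_absorb2)
  also have "\<dots> = ennreal (w e)
      * (\<integral>\<^sup>+t. indicator (seg (u, v) ` {a..b}) (seg (u, v) t) * indicator {0..1} t \<partial>lborel)"
    by (rule nn_integral_edge[OF e]) simp
  also have "\<dots> = ennreal (w e) * (\<integral>\<^sup>+t. indicator {a..b} t \<partial>lborel)"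
    using ab joins_seg_eq_iff[OF e]
    by (intro arg_cong2[where f="(*)"] nn_integral_cong refl) (auto simp: indicator_def)
  also have "\<dots> = ennreal (w e * (b - a))"
    using ab w_pos joinsD(1)[OF e] by (simp add: ennreal_mult less_imp_le)
  finally show ?thesis
    using ab w_pos joinsD(1)[OF e] by (simp add: measure_def less_imp_le)
qed

lemma measure_edge_set: "e \<in> E \<Longrightarrow> measure \<Lambda> (edge_set e) = w e"
  using joins_ex[of e] measure_segment[of e _ _ 0 1] joinsD(5) by fastforce

text \<open>No edge is degenerate, so \<open>seg e\<close> is injective and only finitely many
  parameters hit \<open>F\<close>.\<close>

lemma finite_null: "finite F \<Longrightarrow> F \<in> null_sets \<Lambda>"
proof (intro null_setsI)
  assume F: "finite F"
  then show "F \<in> sets \<Lambda>" by (simp add: finite_imp_closed)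
  have "emeasure lborel {t \<in> {0..1}. seg e t \<in> F} = 0" if "e \<in> E" for e
  proof (rule emeasure_lborel_countable)
    have "inj_on (seg e) {t \<in> {0..1}. seg e t \<in> F}"
      using E_loopfree that seg_eq_iff[of "fst e" "snd e"] by (auto simp: inj_on_def)
    moreover have "seg e ` {t \<in> {0..1}. seg e t \<in> F} \<subseteq> F" by auto
    ultimately show "countable {t \<in> {0..1}. seg e t \<in> F}"
      using F finite_subset finite_imageD countable_finite by metis
  qed
  then show "emeasure \<Lambda> F = 0"
    using F finite_edges by (simp add: emeasure_lam finite_imp_closed)
qed

lemma measure_finite: "finite F \<Longrightarrow> measure \<Lambda> F = 0"
  using finite_null by (simp add: measure_eq_0_null_sets)

lemma borel_edge_int [measurable]: "edge_int e \<in> sets borel"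
  using finite_nodes by (simp add: edge_int_def finite_imp_closed)

lemma borel_G [measurable]: "G \<in> sets borel"
  using compact_G compact_imp_closed borel_closed by blast

text \<open>\<open>lam\<close> lives on the whole space, so besides the nodes also the complement of
  the graph has to be discarded; no parameter of any edge leads there. This is what permits
  pointwise formulas that hold only on open edges.\<close>

lemma AE_edge_int: "AE x in \<Lambda>. x \<in> (\<Union>e\<in>E. edge_int e)"
proof -
  have "{t \<in> {0..1}. seg e t \<in> - G} = {}" if "e \<in> E" for e
    using that edge_set_subset_G[OF that] by (force simp: edge_set_def closed_segment_eq_seg[of "fst e" "snd e"])
  then have "(\<Sum>e\<in>E. ennreal (w e) * emeasure lborel {t \<in> {0..1}. seg e t \<in> - G}) = 0"
    by (intro sum.neutral ballI) (simp only: emeasure_empty mult_zero_right)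
  then have "- G \<in> null_sets \<Lambda>"
    using finite_edges emeasure_lam[of E "- G" w] by (intro null_setsI) auto
  then have "AE x in \<Lambda>. x \<notin> - G \<union> V"
    using finite_null[OF finite_nodes] by (intro AE_not_in null_sets.Un)
  then show ?thesis
    by (elim eventually_mono) (use G_eq in auto)
qed

lemma measure_null_Int:
  assumes "A \<in> sets borel" "B \<in> sets borel" "finite (A \<inter> B)"
  shows "measure \<Lambda> (A \<union> B) = measure \<Lambda> A + measure \<Lambda> B"
  using length_measure.finite_measure_Union'[of A B] length_measure.finite_measure_Diff'[of B A]
    measure_finite[OF assms(3)] assms
  by (simp add: Int_commute)

end

section \<open>Uniqueness of shortest paths forces a tree\<close>

locale unique_path_graph = metric_graph +
  fixes z0 :: "'a::euclidean_space"
  assumes z0: "z0 \<in> V"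
    and unique_sp: "\<forall>x\<in>gset V E. \<exists>!A. is_sp V E w z0 x A"
begin

abbreviation "path_to \<equiv> sp V E w z0"
abbreviation "depth \<equiv> gdist V E w z0"
abbreviation "below \<equiv> gam V E w z0"
abbreviation "weight \<equiv> what V E w z0"

section \<open>Shortest paths from the root and their lengths\<close>

lemma z0_in_G: "z0 \<in> G"
  using z0 V_subset_G by blast

text \<open>Absorbs the separate case of equal ends in \<open>is_sp\<close>: a trivial arc has
  length 0, and \<open>gdist\<close> is 0 there by definition.\<close>

lemma is_sp_iff: "is_sp V E w z0 x A \<longleftrightarrow> arcset z0 x A \<and> measure \<Lambda> A = depth x"
  using z0_in_G measure_finite[of "{z0}"] by (auto simp: is_sp_def arcset_def gdist_def)

lemma
  assumes "x \<in> G"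
  shows arcset_path_to: "arcset z0 x (path_to x)"
    and measure_path_to: "measure \<Lambda> (path_to x) = depth x"
  using theI'[OF unique_sp[rule_format, OF assms]] by (simp_all add: sp_def is_sp_iff)

lemma depth_le:
  assumes "arcset z0 x A"
  shows "depth x \<le> measure \<Lambda> A"
proof (cases "x = z0")
  case False
  then show ?thesis
    using assms unfolding gdist_def arcset_def
    by (auto intro!: cInf_lower bdd_belowI[of _ 0])
qed (simp add: gdist_def)

text \<open>The way in which uniqueness is used throughout: any arc from the root that is no longer
  than the distance has to be the shortest path.\<close>

lemma path_to_eqI:
  assumes "arcset z0 x A" "measure \<Lambda> A \<le> depth x"
  shows "path_to x = A"
proof -
  have "x \<in> G" using assms arcset_ends arcset_subset by blast
  moreover have "is_sp V E w z0 x A"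
    using assms depth_le[OF assms(1)] by (simp add: is_sp_iff)
  ultimately show ?thesis
    unfolding sp_def using unique_sp by (intro the1_equality) auto
qed

lemma node_in_G: "x \<in> V \<Longrightarrow> x \<in> G"
  using V_subset_G by blast

lemma node_path_interior:
  assumes "x \<in> V" "e \<in> E" "path_to x \<inter> edge_int e \<noteq> {}"
  shows "edge_set e \<subseteq> path_to x"
  using node_arcset_interior[OF z0 assms(1) arcset_path_to] assms node_in_G by blast

lemma borel_path_to [measurable]: "x \<in> G \<Longrightarrow> path_to x \<in> sets borel"
  using arcset_path_to borel_arcset by blast

lemma measure_mono: "A \<subseteq> B \<Longrightarrow> B \<in> sets borel \<Longrightarrow> measure \<Lambda> A \<le> measure \<Lambda> B"
  by (rule length_measure.finite_measure_mono) auto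

lemma measure_cut:
  assumes "arcset a y P" "arcset y b Q" "P \<inter> Q = {y}"
  shows "measure \<Lambda> (P \<union> Q) = measure \<Lambda> P + measure \<Lambda> Q"
  using assms borel_arcset by (intro measure_null_Int) auto

text \<open>A connected set with two points is infinite, so it leaves the finite set
  \<open>V\<close>, meets an open edge, and then contains that entire edge.\<close>

lemma arcset_measure_pos:
  assumes "a \<in> V" "b \<in> V" "a \<noteq> b" and A: "arcset a b A"
  shows "0 < measure \<Lambda> A"
proof -
  have "infinite A"
    using connected_finite_iff_sing[OF connected_arcset[OF A]] arcset_ends[OF A] \<open>a \<noteq> b\<close> by auto
  then have "\<not> A \<subseteq> V"
    using finite_nodes finite_subset by blast
  then obtain e where e: "e \<in> E" "A \<inter> edge_int e \<noteq> {}"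
    using arcset_subset[OF A] G_eq by blast
  then have "edge_set e \<subseteq> A"
    using node_arcset_interior assms by blast
  then have "w e \<le> measure \<Lambda> A"
    using measure_mono[of "edge_set e" A] measure_edge_set[OF e(1)] borel_arcset[OF A] by simp
  then show ?thesis using w_pos e(1) by force
qed

text \<open>The remaining piece from \<open>v\<close> to \<open>u\<close> has positive length. In
  particular two distinct nodes cannot each lie on the shortest path to the other.\<close>

lemma depth_on_path:
  assumes "u \<in> V" "v \<in> V" "u \<noteq> v" "v \<in> path_to u"
  shows "depth v < depth u"
proof -
  have A: "arcset z0 u (path_to u)" "measure \<Lambda> (path_to u) = depth u"
    using assms node_in_G arcset_path_to measure_path_to by auto
  obtain P Q where PQ: "arcset z0 v P" "arcset v u Q" "P \<union> Q = path_to u" "P \<inter> Q = {v}"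
    using arcset_cut[OF A(1) assms(4)] .
  have "depth u = measure \<Lambda> P + measure \<Lambda> Q"
    using measure_cut[OF PQ(1,2,4)] PQ(3) A by simp
  then show ?thesis
    using depth_le[OF PQ(1)] arcset_measure_pos[OF _ _ _ PQ(2)] assms by auto
qed

lemma
  assumes e: "joins e u v" and P: "arcset a u P" and t: "0 \<le> t" "t \<le> 1"
    and disj: "P \<inter> seg (u, v) ` {0..t} = {u}"
  shows arcset_extend: "arcset a (seg (u, v) t) (P \<union> seg (u, v) ` {0..t})"
    and measure_extend: "measure \<Lambda> (P \<union> seg (u, v) ` {0..t}) = measure \<Lambda> P + w e * t"
proof -
  have Q: "arcset u (seg (u, v) t) (seg (u, v) ` {0..t})"
    using arcset_segment[OF e t] .
  show "arcset a (seg (u, v) t) (P \<union> seg (u, v) ` {0..t})"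
    using arcset_concat[OF P Q disj] .
  show "measure \<Lambda> (P \<union> seg (u, v) ` {0..t}) = measure \<Lambda> P + w e * t"
    using measure_cut[OF P Q disj] measure_segment[OF e, of 0 t] t by simp
qed

lemma seg_image_swap: "seg (v, u) ` {a..b} = seg (u, v) ` {1 - b..1 - a}"
proof -
  have "seg (v, u) ` {a..b} = seg (u, v) ` (\<lambda>t. 1 - t) ` {a..b}"
    unfolding image_image by (intro image_cong refl) (rule seg_swap)
  then show ?thesis by simp
qed

text \<open>Whichever end the arc enters through, it has already paid the distance of that end and
  then pays for the part of the edge up to the point.\<close>

lemma measure_interior_lower:
  assumes e: "joins e u v" and s: "0 < s" "s < 1" and A: "arcset z0 (seg (u, v) s) A"
  shows "depth u + w e * s \<le> measure \<Lambda> A \<or> depth v + w e * (1 - s) \<le> measure \<Lambda> A"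
proof -
  have *: "depth a + w e * t \<le> measure \<Lambda> A"
    if ab: "joins e a b" and P: "arcset z0 a P" "P \<union> seg (a, b) ` {0..t} \<subseteq> A"
      "P \<inter> seg (a, b) ` {0..t} = {a}" and "0 \<le> t" "t \<le> 1" for a b P t
    using measure_extend[OF ab P(1) that(5,6) P(3)] measure_mono[OF P(2) borel_arcset[OF A]]
      depth_le[OF P(1)] by linarith
  show ?thesis
    using arcset_to_interior[OF z0 A e refl s] *[OF e, of _ s] *[OF joins_sym[OF e], of _ "1 - s"] s
    by (auto simp: seg_image_swap[of v u])
qed

text \<open>By \<open>long\<close>, the path to \<open>u\<close> prolonged along \<open>e\<close> is
  no longer than the distance of \<open>v\<close>. It is an arc, since the deeper node
  \<open>v\<close> cannot lie on the path to \<open>u\<close>; uniqueness does the rest.\<close>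

lemma long_edge:
  assumes e: "joins e u v" and long: "depth u + w e \<le> depth v" and out: "path_to u \<inter> edge_int e = {}"
  shows "path_to v = path_to u \<union> edge_set e" "path_to u \<inter> edge_set e = {u}"
proof -
  note j = joinsD[OF e]
  have "v \<notin> path_to u"
    using depth_on_path[of u v] j long w_pos by force
  moreover have u: "arcset z0 u (path_to u)" "measure \<Lambda> (path_to u) = depth u"
    using j node_in_G arcset_path_to measure_path_to by auto
  ultimately show *: "path_to u \<inter> edge_set e = {u}"
    using out edge_set_eq[OF e] arcset_ends[OF u(1)] by auto
  show "path_to v = path_to u \<union> edge_set e"
    using arcset_extend[OF e u(1), of 1] measure_extend[OF e u(1), of 1] * u(2) long
    by (intro path_to_eqI) (simp_all add: j(5))
qed

text \<open>The edge \<open>e\<close> joins the parent \<open>u\<close> to its child \<open>v\<close>, as seen from the root.\<close>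
definition down :: "'a \<times> 'a \<Rightarrow> 'a \<Rightarrow> 'a \<Rightarrow> bool" where
  "down e u v \<longleftrightarrow> joins e u v \<and> edge_set e \<subseteq> path_to v \<and> \<not> edge_set e \<subseteq> path_to u"

text \<open>Cut the path to \<open>v\<close> at \<open>u\<close>. The first piece misses
  \<open>v\<close>, hence misses the open edge, so the second piece contains all of
  \<open>e\<close>. This gives \<open>depth u + w e \<le> depth v\<close>, and
  \<open>long_edge\<close> applies.\<close>

lemma downD:
  assumes "down e u v"
  shows "joins e u v" "path_to v = path_to u \<union> edge_set e" "path_to u \<inter> edge_set e = {u}"
    and "depth v = depth u + w e"
proof -
  show e: "joins e u v" using assms by (simp add: down_def)
  note j = joinsD[OF e]
  have out: "path_to u \<inter> edge_int e = {}"
    using assms node_path_interior[of u e] j by (auto simp: down_def)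
  have sub: "edge_set e \<subseteq> path_to v"
    using assms by (simp add: down_def)
  have ends: "u \<in> edge_set e" "v \<in> edge_set e"
    using edge_set_eq[OF e] by auto
  have v: "arcset z0 v (path_to v)" "measure \<Lambda> (path_to v) = depth v"
    using j node_in_G arcset_path_to measure_path_to by auto
  obtain P Q where PQ: "arcset z0 u P" "arcset u v Q" "P \<union> Q = path_to v" "P \<inter> Q = {u}"
    using arcset_cut[OF v(1)] sub ends by blast
  have "v \<notin> P"
    using PQ(4) arcset_ends[OF PQ(2)] j(2) by auto
  then have "P \<inter> edge_int e = {}"
    using node_arcset_interior[OF z0 j(3) PQ(1) j(1)] ends by blast
  then have "Q \<inter> edge_int e \<noteq> {}"
    using sub PQ(3) edge_int_nonempty[OF j(1)] edge_int_subset by blast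
  then have "edge_set e \<subseteq> Q"
    using node_arcset_interior[OF j(3,4) PQ(2) j(1)] by blast
  then have "w e \<le> measure \<Lambda> Q"
    using measure_mono[of "edge_set e" Q] measure_edge_set[OF j(1)] borel_arcset[OF PQ(2)] by simp
  then have long: "depth u + w e \<le> depth v"
    using measure_cut[OF PQ(1,2,4)] PQ(3) v(2) depth_le[OF PQ(1)] by simp
  show split: "path_to v = path_to u \<union> edge_set e" "path_to u \<inter> edge_set e = {u}"
    using long_edge[OF e long out] by auto
  have "arcset z0 u (path_to u)" "measure \<Lambda> (path_to u) = depth u"
    using j node_in_G arcset_path_to measure_path_to by auto
  then show "depth v = depth u + w e"
    using measure_extend[OF e, of z0 "path_to u" 1] split v(2) j(5) by simp
qed

text \<open>If \<open>e\<close> lay on the shortest paths to both of its ends, each end would be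
  strictly nearer to the root than the other. The case of \<open>e\<close> on neither path is
  refuted by a point with two shortest paths.\<close>

lemma down_ex:
  assumes "e \<in> E"
  obtains u v where "down e u v"
proof -
  obtain u v where e: "joins e u v" using joins_ex[OF assms] by blast
  note j = joinsD[OF e]
  have ends: "u \<in> edge_set e" "v \<in> edge_set e"
    using edge_set_eq[OF e] by auto
  have "w e > 0" using w_pos assms by blast
  consider "down e u v" | "down e v u" | "edge_set e \<subseteq> path_to u" "edge_set e \<subseteq> path_to v"
    | "\<not> edge_set e \<subseteq> path_to u" "\<not> edge_set e \<subseteq> path_to v"
    using e joins_sym[OF e] by (auto simp: down_def)
  then show ?thesis
  proof cases
    case 3
    then show ?thesis
      using depth_on_path[of u v] depth_on_path[of v u] j(2-4) ends by fastforce
  next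
    case 4
    then have out: "path_to u \<inter> edge_int e = {}" "path_to v \<inter> edge_int e = {}"
      using node_path_interior[of _ e] j(1,3,4) by blast+
    \<comment> \<open>Contraposition of \<open>long_edge\<close>: a depth difference of at least
      \<open>w e\<close> would put \<open>e\<close> on one of the two shortest paths.\<close>
    have "depth v < depth u + w e" "depth u < depth v + w e"
      using long_edge(1)[OF e _ out(1)] long_edge(1)[OF joins_sym[OF e] _ out(2)] 4 by force+
    \<comment> \<open>The balance point, at which the routes through \<open>u\<close> and through
      \<open>v\<close> are equally long. The two strict inequalities place it in the interior of the
      edge.\<close>
    define t where "t = (depth v - depth u + w e) / (2 * w e)"
    have t: "0 < t" "t < 1"
      using \<open>depth v < depth u + w e\<close> \<open>depth u < depth v + w e\<close> \<open>w e > 0\<close> by (auto simp: t_def field_simps)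
    have eq: "depth u + w e * t = depth v + w e * (1 - t)"
      using \<open>w e > 0\<close> by (simp add: t_def field_simps)
    define x where "x = seg (u, v) t"
    have int: "seg (u, v) s \<in> edge_int e" if "0 < s" "s < 1" for s
      using that edge_int_eq[OF e] by auto
    have "x \<in> edge_int e"
      using int[OF t] by (simp add: x_def)
    then have "x \<in> G"
      using edge_int_subset edge_set_subset_G[OF assms] by blast
    then have lower: "depth u + w e * t \<le> depth x"
      using measure_interior_lower[OF e t] arcset_path_to[of x] measure_path_to[of x] eq
      by (fastforce simp: x_def)
    have u: "arcset z0 u (path_to u)" "measure \<Lambda> (path_to u) = depth u"
      and v: "arcset z0 v (path_to v)" "measure \<Lambda> (path_to v) = depth v"
      using j node_in_G arcset_path_to measure_path_to by auto
    have "seg (u, v) s \<in> insert u (edge_int e)" if "0 \<le> s" "s \<le> t" for s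
      using int[of s] that t by (cases "s = 0") auto
    moreover have "seg (u, v) s \<in> insert v (edge_int e)" if "t \<le> s" "s \<le> 1" for s
      using int[of s] that t by (cases "s = 1") auto
    ultimately have "seg (u, v) ` {0..t} \<subseteq> insert u (edge_int e)"
      "seg (u, v) ` {t..1} \<subseteq> insert v (edge_int e)"
      by (simp_all add: image_subset_iff)
    then have disj: "path_to u \<inter> seg (u, v) ` {0..t} = {u}" "path_to v \<inter> seg (v, u) ` {0..1 - t} = {v}"
      using out arcset_ends[OF u(1)] arcset_ends[OF v(1)] t
      by (auto simp: seg_image_swap[of v u] intro!: image_eqI[of u _ 0] image_eqI[of v _ 1])
    have x': "x = seg (v, u) (1 - t)"
      by (simp add: x_def seg_swap[of v u])
    have "path_to x = path_to u \<union> seg (u, v) ` {0..t}"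
      using arcset_extend[OF e u(1) _ _ disj(1)] measure_extend[OF e u(1) _ _ disj(1)] t lower u(2)
      by (intro path_to_eqI) (simp_all add: x_def)
    moreover have "path_to x = path_to v \<union> seg (v, u) ` {0..1 - t}"
      using arcset_extend[OF joins_sym[OF e] v(1) _ _ disj(2)] measure_extend[OF joins_sym[OF e] v(1) _ _ disj(2)]
        t lower v(2) eq
      by (intro path_to_eqI) (simp_all add: x')
    \<comment> \<open>A witness that the two routes differ as sets: this point lies on the route
      through \<open>u\<close>, whereas the route through \<open>v\<close> covers only parameters
      from \<open>t\<close> on.\<close>
    ultimately have "seg (u, v) (t / 2) \<in> path_to v \<union> seg (u, v) ` {t..1}"
      using t by (force simp: seg_image_swap[of v u])
    moreover have "seg (u, v) (t / 2) \<in> edge_int e"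
      using t by (intro int) auto
    ultimately show ?thesis
      using out(2) t joins_seg_eq_iff[OF e] by auto
  qed (use that in blast)+
qed

text \<open>Coming from the far end is never shorter: it costs
  \<open>depth u + w e + w e * (1 - t)\<close>, against \<open>depth u + w e * t\<close> from
  \<open>u\<close>.\<close>

lemma path_to_seg:
  assumes d: "down e u v" and t: "0 \<le> t" "t \<le> 1"
  shows "path_to (seg (u, v) t) = path_to u \<union> seg (u, v) ` {0..t}"
proof -
  note e = downD(1)[OF d]
  note j = joinsD[OF e]
  have u: "arcset z0 u (path_to u)" "measure \<Lambda> (path_to u) = depth u"
    using j node_in_G arcset_path_to measure_path_to by auto
  have sub: "seg (u, v) ` {0..t} \<subseteq> edge_set e"
    using t j(5) by auto
  have "u \<in> seg (u, v) ` {0..t}"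
    using t by (intro image_eqI[of u _ 0]) auto
  then have disj: "path_to u \<inter> seg (u, v) ` {0..t} = {u}"
    using downD(3)[OF d] sub by auto
  consider "t = 0" | "t = 1" | "0 < t" "t < 1"
    using t by linarith
  then show ?thesis
  proof cases
    case 1
    then show ?thesis using arcset_ends[OF u(1)] by auto
  next
    case 2
    then show ?thesis using downD(2)[OF d] j(5) by simp
  next
    case 3
    have "seg (u, v) t \<in> G"
      using t j(5,7) by force
    moreover have "w e * (1 - t) \<ge> 0" "w e * t \<le> w e"
      using w_pos j(1) t by (simp_all add: less_imp_le mult_left_le)
    ultimately have "depth u + w e * t \<le> depth (seg (u, v) t)"
      using measure_interior_lower[OF e 3 arcset_path_to] measure_path_to downD(4)[OF d] by force
    then show ?thesis
      using arcset_extend[OF e u(1) t disj] measure_extend[OF e u(1) t disj] u(2)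
      by (intro path_to_eqI) auto
  qed
qed

section \<open>The part of the graph behind an edge, and the weight on open edges\<close>

lemma mem_below_iff: "y \<in> below e \<longleftrightarrow> y \<in> G \<and> edge_set e \<subseteq> path_to y"
  by (simp add: gam_def)

text \<open>The path to a point of \<open>e\<close> short of \<open>v\<close> stops before reaching
  \<open>v\<close>. The overlap is thus a single null point, so the lengths of
  \<open>below e\<close> and of a final piece of \<open>e\<close> simply add up in the
  weight.\<close>

lemma below_Int_edge:
  assumes d: "down e u v"
  shows "below e \<inter> edge_set e = {v}"
proof -
  note e = downD(1)[OF d]
  have "v \<in> edge_set e" "u \<in> edge_set e"
    using edge_set_eq[OF e] by auto
  then have "v \<notin> path_to u"
    using downD(3)[OF d] joinsD(2)[OF e] by auto
  have t1: "t = 1" if t: "0 \<le> t" "t \<le> 1" "seg (u, v) t \<in> below e" for t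
  proof -
    have "v \<in> seg (u, v) ` {0..t}"
      using that(3) \<open>v \<in> edge_set e\<close> \<open>v \<notin> path_to u\<close> path_to_seg[OF d t(1,2)]
      by (auto simp: mem_below_iff)
    then obtain s where "s \<le> t" "seg (u, v) s = v"
      by force
    then show ?thesis
      using t(2) seg_eq_ends(2)[OF joinsD(2)[OF e], of s] by simp
  qed
  have "v \<in> below e"
    using d joinsD(4)[OF e] node_in_G by (auto simp: mem_below_iff down_def)
  moreover have "y = v" if "y \<in> below e" "y \<in> edge_set e" for y
  proof -
    obtain t where "0 \<le> t" "t \<le> 1" "y = seg (u, v) t"
      using \<open>y \<in> edge_set e\<close> joinsD(5)[OF e] by auto
    then show ?thesis
      using t1[of t] \<open>y \<in> below e\<close> by simp
  qed
  ultimately show ?thesis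
    using \<open>v \<in> edge_set e\<close> by blast
qed

text \<open>Moving along \<open>e'\<close> changes the shortest path only inside \<open>e'\<close>,
  which is disjoint from the open edge \<open>e\<close>. Hence membership in \<open>below e\<close>
  is constant along \<open>e'\<close>.\<close>

lemma edge_subset_path_other:
  assumes "e \<in> E" and d': "down e' u' v'" and "e \<noteq> e'" and t: "0 \<le> t" "t \<le> 1"
  shows "edge_set e \<subseteq> path_to (seg (u', v') t) \<longleftrightarrow> edge_set e \<subseteq> path_to u'"
    and "edge_int e \<inter> path_to (seg (u', v') t) \<noteq> {} \<longrightarrow> edge_set e \<subseteq> path_to u'"
proof -
  note e' = downD(1)[OF d']
  have "seg (u', v') ` {0..t} \<subseteq> edge_set e'"
    using joinsD(5)[OF e'] t by auto
  then have *: "edge_int e \<inter> path_to (seg (u', v') t) = edge_int e \<inter> path_to u'"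
    using edge_int_disjoint[OF assms(1) joinsD(1)[OF e'] assms(3)] path_to_seg[OF d' t] by auto
  then show "edge_int e \<inter> path_to (seg (u', v') t) \<noteq> {} \<longrightarrow> edge_set e \<subseteq> path_to u'"
    using node_path_interior[of u' e] joinsD(3)[OF e'] assms(1) by blast
  then show "edge_set e \<subseteq> path_to (seg (u', v') t) \<longleftrightarrow> edge_set e \<subseteq> path_to u'"
    using path_to_seg[OF d' t] edge_int_nonempty[OF assms(1)] edge_int_subset[of e] by blast
qed

lemma borel_below [measurable]:
  assumes "e \<in> E"
  shows "below e \<in> sets borel"
proof -
  obtain u v where d: "down e u v" using down_ex[OF assms] .
  have "below e \<inter> edge_int e' \<in> {{}, edge_int e'}" if e': "e' \<in> E" for e'
  proof (cases "e' = e")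
    case True
    have "v \<notin> edge_int e"
      using joinsD(4)[OF downD(1)[OF d]] by (simp add: edge_int_def)
    then have "below e \<inter> edge_int e = {}"
      using below_Int_edge[OF d] by (auto simp: edge_int_def)
    then show ?thesis
      using True by simp
  next
    case False
    obtain u' v' where d': "down e' u' v'" using down_ex[OF e'] .
    have "y \<in> below e \<longleftrightarrow> edge_set e \<subseteq> path_to u'" if y: "y \<in> edge_int e'" for y
    proof -
      obtain t where "0 < t" "t < 1" "y = seg (u', v') t"
        using edge_intE[OF downD(1)[OF d'] y] .
      moreover have "y \<in> G"
        using y edge_int_subset edge_set_subset_G[OF \<open>e' \<in> E\<close>] by blast
      ultimately show ?thesis
        using edge_subset_path_other(1)[OF assms d'] False by (simp add: mem_below_iff)
    qed
    then show ?thesis by blast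
  qed
  then have "below e \<inter> edge_int e' \<in> sets borel" if "e' \<in> E" for e'
    using that by (metis borel_edge_int empty_iff insert_iff sets.empty_sets)
  moreover have "below e = (below e \<inter> V) \<union> (\<Union>e'\<in>E. below e \<inter> edge_int e')"
    using G_eq by (auto simp: gam_def)
  moreover have "below e \<inter> V \<in> sets borel"
    using finite_nodes by (simp add: finite_imp_closed)
  ultimately show ?thesis
    using finite_edges by (metis (no_types, lifting) sets.Un sets.finite_UN)
qed

text \<open>A shortest path through an interior point of \<open>e\<close> either ends on
  \<open>e\<close> at or after this point, or contains \<open>e\<close>: for nodes by
  \<open>node_path_interior\<close>, for points of other edges by
  \<open>edge_subset_path_other\<close>.\<close>

lemma Lam_seg:
  assumes d: "down e u v" and t: "0 < t" "t < 1"
  shows "Lam V E w z0 (seg (u, v) t) = below e \<union> seg (u, v) ` {t..1}"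
proof -
  note e = downD(1)[OF d]
  note j = joinsD[OF e]
  define x where "x = seg (u, v) t"
  have x: "x \<in> edge_int e"
    using t edge_int_eq[OF e] by (auto simp: x_def)
  then have xe: "x \<in> edge_set e"
    using edge_int_subset by blast
  have "x \<notin> path_to u"
    using downD(3)[OF d] xe x j(3) by (auto simp: edge_int_def)
  then have on_edge: "x \<in> path_to (seg (u, v) s) \<longleftrightarrow> t \<le> s" if "0 \<le> s" "s \<le> 1" for s
    using path_to_seg[OF d that] t joins_seg_eq_iff[OF e] that by (auto simp: x_def)
  have "y \<in> below e \<union> seg (u, v) ` {t..1}" if y: "y \<in> G" "x \<in> path_to y" for y
  proof -
    consider "y \<in> V" | "y \<in> edge_int e" | e' where "e' \<in> E" "e' \<noteq> e" "y \<in> edge_int e'"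
      using y(1) G_eq by auto
    then show ?thesis
    proof cases
      case 1
      then show ?thesis
        using node_path_interior[of y e] j(1) x y by (auto simp: mem_below_iff)
    next
      case 2
      then obtain s where "0 < s" "s < 1" "y = seg (u, v) s"
        using edge_int_eq[OF e] by auto
      then show ?thesis using on_edge[of s] y(2) by auto
    next
      case 3
      obtain u' v' where d': "down e' u' v'" using down_ex[OF 3(1)] .
      obtain s where s: "0 < s" "s < 1" "y = seg (u', v') s"
        using edge_intE[OF downD(1)[OF d'] 3(3)] .
      then have "edge_set e \<subseteq> path_to y"
        using edge_subset_path_other[OF j(1) d', of s] 3(2) y(2) x by auto
      then show ?thesis using y(1) by (simp add: mem_below_iff)
    qed
  qed
  moreover have "x \<in> path_to y" "y \<in> G" if "y \<in> below e" for y
    using that xe by (auto simp: mem_below_iff)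
  moreover have "x \<in> path_to y" "y \<in> G" if "y \<in> seg (u, v) ` {t..1}" for y
    using that on_edge t j(5,7) by force+
  ultimately show ?thesis
    unfolding Lam_def x_def[symmetric] by blast
qed

lemma weight_seg:
  assumes d: "down e u v" and t: "0 < t" "t < 1"
  shows "weight (seg (u, v) t) = 1 + measure \<Lambda> (below e) + w e * (1 - t)"
proof -
  note e = downD(1)[OF d]
  have "seg (u, v) ` {t..1} \<subseteq> edge_set e"
    using joinsD(5)[OF e] t by auto
  then have "below e \<inter> seg (u, v) ` {t..1} \<subseteq> {v}"
    using below_Int_edge[OF d] by auto
  then have "measure \<Lambda> (below e \<union> seg (u, v) ` {t..1}) = measure \<Lambda> (below e) + measure \<Lambda> (seg (u, v) ` {t..1})"
    using joinsD(1)[OF e] closed_seg_image[of "(u, v)" t 1]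
    by (intro measure_null_Int) (auto intro: finite_subset)
  then show ?thesis
    using measure_segment[OF e, of t 1] t Lam_seg[OF d t] by (simp add: what_def)
qed

end

section \<open>The weight and integrals along shortest paths\<close>

context unique_path_graph
begin

lemma weight_ge_1: "1 \<le> weight x"
  by (simp add: what_def)

lemma weight_pos: "0 < weight x"
  using weight_ge_1[of x] by linarith

text \<open>The weight is defined pointwise through lengths of sets, which says nothing about
  measurability in \<open>x\<close>. On an open edge it agrees with a continuous function of the
  whole space, because the parameter of \<open>x\<close> is
  \<open>dist u x / dist u v\<close>.\<close>

lemma measurable_weight_edge [measurable]:
  assumes "e \<in> E"
  shows "(\<lambda>x. indicator (edge_int e) x * weight x powr s) \<in> borel_measurable borel"
proof -
  obtain u v where d: "down e u v" using down_ex[OF assms] .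
  note e = downD(1)[OF d]
  define g where "g x = 1 + measure \<Lambda> (below e) + w e * (1 - dist u x / dist u v)" for x
  have "weight x = g x" if x: "x \<in> edge_int e" for x
  proof -
    obtain t where t: "0 < t" "t < 1" "x = seg (u, v) t"
      using edge_intE[OF e x] .
    have "dist u x = t * dist u v"
      using dist_seg[of u v 0 t] t by simp
    then show ?thesis
      using weight_seg[OF d t(1,2)] t joinsD(2)[OF e] by (simp add: g_def)
  qed
  then have "(\<lambda>x. indicator (edge_int e) x * weight x powr s) = (\<lambda>x. indicator (edge_int e) x * g x powr s)"
    by (auto simp: indicator_def)
  also have "\<dots> \<in> borel_measurable borel"
    unfolding g_def by measurable
  finally show ?thesis .
qed

lemma nn_integral_weight:
  assumes "e \<in> E"
  shows "(\<integral>\<^sup>+x. ennreal (indicator (edge_int e) x * weight x powr (1 - p)) \<partial>\<Lambda>) = ennreal (beta V E w z0 p e)"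
    and "0 \<le> beta V E w z0 p e"
proof -
  obtain u v where d: "down e u v" using down_ex[OF assms] .
  note e = downD(1)[OF d]
  define L where "L = measure \<Lambda> (below e)"
  define W where "W = w e"
  have L: "0 \<le> L" and W: "0 < W"
    using w_pos assms by (simp_all add: L_def W_def)
  \<comment> \<open>An antiderivative of \<open>x powr (1 - p)\<close>; the logarithm at exponent -1
    is the source of the case \<open>p = 2\<close> in \<open>beta\<close>.\<close>
  define \<Phi> where "\<Phi> x = (if p = 2 then ln x else x powr (2 - p) / (2 - p))" for x :: real
  have D\<Phi>: "(\<Phi> has_real_derivative x powr (1 - p)) (at x)" if "0 < x" for x
  proof (cases "p = 2")
    case True
    then show ?thesis
      unfolding \<Phi>_def using that by (auto intro!: derivative_eq_intros simp: powr_minus divide_simps)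
  next
    case False
    then show ?thesis
      unfolding \<Phi>_def using that by (auto intro!: derivative_eq_intros)
  qed
  have beta_eq: "beta V E w z0 p e = \<Phi> (1 + L + W) - \<Phi> (1 + L)"
  proof (cases "p = 2")
    case True
    have "1 + W / (1 + L) = (1 + L + W) / (1 + L)"
      using L by (simp add: field_simps)
    then show ?thesis
      using True L W by (simp add: beta_def \<Phi>_def L_def[symmetric] W_def[symmetric] ln_div)
  next
    case False
    then show ?thesis
      by (simp add: beta_def \<Phi>_def L_def[symmetric] W_def[symmetric] diff_divide_distrib)
  qed
  \<comment> \<open>For \<open>p > 2\<close> numerator and denominator of \<open>beta\<close> are
    both negative, so the sign is settled for all \<open>p\<close> at once by monotonicity of the
    antiderivative.\<close>
  have "\<Phi> (1 + L) \<le> \<Phi> (1 + L + W)"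
  proof (rule DERIV_nonneg_imp_nondecreasing[of "1 + L" "1 + L + W" \<Phi>])
    show "1 + L \<le> 1 + L + W" using W by simp
    fix x assume "1 + L \<le> x"
    then have "(\<Phi> has_real_derivative x powr (1 - p)) (at x)"
      using L by (intro D\<Phi>) linarith
    then show "\<exists>y. (\<Phi> has_real_derivative y) (at x) \<and> 0 \<le> y"
      by (intro exI conjI) (assumption, simp)
  qed
  then show nonneg: "0 \<le> beta V E w z0 p e"
    by (simp add: beta_eq)
  define f where "f t = (1 + L + W * (1 - t)) powr (1 - p)" for t
  \<comment> \<open>Sign and divisor undo the chain-rule factor \<open>- W\<close> of the affine
    weight. The divisor later cancels against the factor \<open>w e\<close> of the length
    measure.\<close>
  define F where "F t = - \<Phi> (1 + L + W * (1 - t)) / W" for t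
  have pos: "0 < 1 + L + W * (1 - t)" if "t \<le> 1" for t
  proof -
    have "0 \<le> W * (1 - t)" using W that by simp
    then show ?thesis using L by linarith
  qed
  have DF: "(F has_real_derivative f t) (at t)" if "t \<le> 1" for t
  proof -
    have "((\<lambda>t. 1 + L + W * (1 - t)) has_real_derivative - W) (at t)"
      by (auto intro!: derivative_eq_intros)
    from DERIV_cdivide[OF DERIV_minus[OF DERIV_chain2[OF D\<Phi>[OF pos[OF that]] this]], of W]
    show ?thesis
      using W by (simp add: F_def[abs_def] f_def)
  qed
  have "(\<integral>\<^sup>+t. ennreal (f t) * indicator {0..1} t \<partial>lborel) = ennreal (F 1 - F 0)"
    using DF by (intro nn_integral_FTC_Icc) (auto simp: f_def)
  also have "F 1 - F 0 = beta V E w z0 p e / W"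
    using W by (simp add: F_def beta_eq diff_divide_distrib)
  finally have f_int: "(\<integral>\<^sup>+t. ennreal (f t) * indicator {0..1} t \<partial>lborel) = ennreal (beta V E w z0 p e / W)" .
  define g where "g x = ennreal (indicator (edge_int e) x * weight x powr (1 - p))" for x
  have [measurable]: "g \<in> borel_measurable borel"
    unfolding g_def using measurable_weight_edge[OF assms] by simp
  have "(\<integral>\<^sup>+x. g x \<partial>\<Lambda>) = (\<integral>\<^sup>+x. g x * indicator (edge_set e) x \<partial>\<Lambda>)"
    using edge_int_subset[of e] by (intro nn_integral_cong) (auto simp: g_def indicator_def)
  also have "\<dots> = ennreal W * (\<integral>\<^sup>+t. g (seg (u, v) t) * indicator {0..1} t \<partial>lborel)"
    unfolding W_def by (rule nn_integral_edge[OF e]) measurable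
  also have "(\<integral>\<^sup>+t. g (seg (u, v) t) * indicator {0..1} t \<partial>lborel)
      = (\<integral>\<^sup>+t. ennreal (f t) * indicator {0..1} t \<partial>lborel)"
  proof (rule nn_integral_cong_AE)
    have "AE t in lborel. t \<notin> {0, 1::real}"
      by (intro AE_not_in countable_imp_null_set_lborel) auto
    then show "AE t in lborel. g (seg (u, v) t) * indicator {0..1} t = ennreal (f t) * indicator {0..1} t"
    proof (rule eventually_mono)
      fix t :: real assume t: "t \<notin> {0, 1}"
      show "g (seg (u, v) t) * indicator {0..1} t = ennreal (f t) * indicator {0..1} t"
      proof (cases "t \<in> {0..1}")
        case True
        then have t': "0 < t" "t < 1" using t by auto
        then have "seg (u, v) t \<in> edge_int e"
          using edge_int_eq[OF e] by auto
        then show ?thesis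
          using weight_seg[OF d t'] by (simp add: g_def f_def L_def W_def)
      qed simp
    qed
  qed
  finally show "(\<integral>\<^sup>+x. ennreal (indicator (edge_int e) x * weight x powr (1 - p)) \<partial>\<Lambda>) = ennreal (beta V E w z0 p e)"
    using f_int W nonneg by (simp add: g_def ennreal_mult[symmetric])
qed

lemma
  assumes "e \<in> E"
  shows integrable_weight: "integrable \<Lambda> (\<lambda>x. indicator (edge_int e) x * weight x powr (1 - p))"
    and integral_weight: "(\<integral>x. indicator (edge_int e) x * weight x powr (1 - p) \<partial>\<Lambda>) = beta V E w z0 p e"
  using nn_integral_eq_integrable[of "\<lambda>x. indicator (edge_int e) x * weight x powr (1 - p)" \<Lambda> "beta V E w z0 p e"]
    nn_integral_weight[OF assms, of p] measurable_weight_edge[OF assms] by auto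

lemma sum_indicator_edge_int:
  fixes k :: "'a \<times> 'a \<Rightarrow> real"
  assumes "e \<in> E" "x \<in> edge_int e"
  shows "(\<Sum>e'\<in>E. indicator (edge_int e') x * k e') = k e"
proof -
  have "indicator (edge_int e') x * k e' = (if e' = e then k e else 0)" if "e' \<in> E" for e'
    using assms that edge_int_disjoint[of e e'] edge_int_subset by (fastforce simp: indicator_def)
  then show ?thesis
    using finite_edges assms(1) by simp
qed

text \<open>Up to a null set, the shortest path to a node is the disjoint union of the open edges
  that it contains.\<close>

lemma path_integral:
  fixes h :: "'a \<Rightarrow> real"
  assumes v: "v \<in> V" and h [measurable]: "h \<in> borel_measurable \<Lambda>"
    and int: "\<And>e. e \<in> E \<Longrightarrow> set_integrable \<Lambda> (edge_int e) h"
  shows "(LINT y:path_to v|\<Lambda>. h y)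
    = (\<Sum>e\<in>E. if edge_set e \<subseteq> path_to v then (LINT y:edge_int e|\<Lambda>. h y) else 0)"
proof -
  define c :: "'a \<times> 'a \<Rightarrow> real" where "c e = (if edge_set e \<subseteq> path_to v then 1 else 0)" for e
  have [measurable]: "path_to v \<in> sets borel"
    using borel_path_to node_in_G[OF v] by blast
  have "(LINT y:path_to v|\<Lambda>. h y) = (\<integral>y. (\<Sum>e\<in>E. c e * (indicator (edge_int e) y *\<^sub>R h y)) \<partial>\<Lambda>)"
    unfolding set_lebesgue_integral_def
  proof (rule integral_cong_AE)
    show "AE y in \<Lambda>. indicator (path_to v) y *\<^sub>R h y = (\<Sum>e\<in>E. c e * (indicator (edge_int e) y *\<^sub>R h y))"
    proof (rule eventually_mono[OF AE_edge_int])
      fix y assume "y \<in> (\<Union>e\<in>E. edge_int e)"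
      then obtain e where e: "e \<in> E" "y \<in> edge_int e" by blast
      have "y \<in> path_to v \<longleftrightarrow> edge_set e \<subseteq> path_to v"
        using node_path_interior[OF v e(1)] e(2) edge_int_subset by blast
      then show "indicator (path_to v) y *\<^sub>R h y = (\<Sum>e\<in>E. c e * (indicator (edge_int e) y *\<^sub>R h y))"
        using sum_indicator_edge_int[OF e, of "\<lambda>e. c e * h y"] by (simp add: c_def ac_simps indicator_def)
    qed
  qed measurable
  also have "\<dots> = (\<Sum>e\<in>E. c e * (LINT y:edge_int e|\<Lambda>. h y))"
    using int unfolding set_integrable_def set_lebesgue_integral_def
    by (subst Bochner_Integration.integral_sum) auto
  also have "\<dots> = (\<Sum>e\<in>E. if edge_set e \<subseteq> path_to v then (LINT y:edge_int e|\<Lambda>. h y) else 0)"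
    by (intro sum.cong) (auto simp: c_def)
  finally show ?thesis .
qed

text \<open>Serves to make the extremal function feasible. With a bounded integrand the path
  integral is Lipschitz on each closed edge, since moving from \<open>s\<close> to \<open>t\<close>
  adds only a piece of length at most \<open>w e * (t - s)\<close>; finitely many closed pieces are
  then pasted together.\<close>

lemma continuous_path_integral:
  fixes h :: "'a \<Rightarrow> real"
  assumes h [measurable]: "h \<in> borel_measurable \<Lambda>" and B: "\<And>x. \<bar>h x\<bar> \<le> B"
  shows "\<And>x. x \<in> G \<Longrightarrow> set_integrable \<Lambda> (path_to x) h"
    and "continuous_on G (\<lambda>x. LINT y:path_to x|\<Lambda>. h y)"
proof -
  have "0 \<le> B" using B[of undefined] by linarith
  have int: "set_integrable \<Lambda> A h" if "A \<in> sets borel" for A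
    unfolding set_integrable_def
    using that B \<open>0 \<le> B\<close> by (intro length_measure.integrable_const_bound[of _ B]) (auto simp: indicator_def)
  show "set_integrable \<Lambda> (path_to x) h" if "x \<in> G" for x
    using borel_path_to[OF that] by (rule int)
  define f where "f x = (LINT y:path_to x|\<Lambda>. h y)" for x
  have "continuous_on (edge_set e) f" if eE: "e \<in> E" for e
  proof -
    obtain u v where d: "down e u v" using down_ex[OF eE] .
    note e = downD(1)[OF d]
    have "0 < dist u v" "0 < w e"
      using joinsD(2)[OF e] w_pos eE by auto
    have step: "\<bar>f (seg (u, v) t) - f (seg (u, v) s)\<bar> \<le> B * w e * (t - s)"
      if st: "0 \<le> s" "s \<le> t" "t \<le> 1" for s t
    proof -
      have inG: "seg (u, v) s \<in> G" "seg (u, v) t \<in> G"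
        using st joinsD(5,7)[OF e] by force+
      define S where "S = path_to (seg (u, v) t) - path_to (seg (u, v) s)"
      have [measurable]: "path_to (seg (u, v) s) \<in> sets borel" "S \<in> sets borel"
        using inG borel_path_to by (auto simp: S_def)
      have "path_to (seg (u, v) s) \<subseteq> path_to (seg (u, v) t)"
        using path_to_seg[OF d] st by auto
      then have "path_to (seg (u, v) t) = path_to (seg (u, v) s) \<union> S" "path_to (seg (u, v) s) \<inter> S = {}"
        by (auto simp: S_def)
      then have "f (seg (u, v) t) - f (seg (u, v) s) = (LINT y:S|\<Lambda>. h y)"
        using int by (simp add: f_def set_integral_Un)
      also have "\<bar>\<dots>\<bar> \<le> (\<integral>y. indicator S y * B \<partial>\<Lambda>)"
        unfolding set_lebesgue_integral_def real_norm_def[symmetric]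
      proof (intro order_trans[OF integral_norm_bound integral_mono])
        show "integrable \<Lambda> (\<lambda>y. norm (indicator S y *\<^sub>R h y))"
          using int[of S] by (intro integrable_norm) (simp add: set_integrable_def)
        show "integrable \<Lambda> (\<lambda>y. indicator S y * B)"
          by (intro integrable_mult_left integrable_real_indicator)
            (auto simp: length_measure.emeasure_finite less_top[symmetric])
      qed (use B in \<open>auto simp: indicator_def\<close>)
      also have "\<dots> = B * measure \<Lambda> S"
        by simp
      also have "\<dots> \<le> B * (w e * (t - s))"
      proof -
        have "S \<subseteq> seg (u, v) ` {s..t}"
          using path_to_seg[OF d, of s] path_to_seg[OF d, of t] st by (force simp: S_def)
        then have "measure \<Lambda> S \<le> measure \<Lambda> (seg (u, v) ` {s..t})"
          by (intro measure_mono borel_closed closed_seg_image)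
        then show ?thesis
          using measure_segment[OF e st] \<open>0 \<le> B\<close> by (simp add: mult_left_mono)
      qed
      finally show ?thesis by simp
    qed
    have "(B * w e / dist u v)-lipschitz_on (edge_set e) f"
    proof (rule lipschitz_onI)
      show "0 \<le> B * w e / dist u v"
        using \<open>0 \<le> B\<close> \<open>0 < w e\<close> by simp
      fix x y assume "x \<in> edge_set e" "y \<in> edge_set e"
      then obtain s t where "x = seg (u, v) s" "y = seg (u, v) t" "0 \<le> s" "s \<le> 1" "0 \<le> t" "t \<le> 1"
        using joinsD(5)[OF e] by auto
      then show "dist (f x) (f y) \<le> B * w e / dist u v * dist x y"
        using step[of s t] step[of t s] \<open>0 < dist u v\<close>
        by (cases "s \<le> t") (auto simp: dist_seg dist_real_def abs_minus_commute)
    qed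
    then show ?thesis by (rule lipschitz_on_continuous_on)
  qed
  then have "continuous_on (V \<union> (\<Union>e\<in>E. edge_set e)) f"
    using finite_nodes finite_edges
    by (intro continuous_on_closed_Un continuous_on_closed_Union closed_UN)
      (auto simp: finite_imp_closed continuous_on_finite)
  then show "continuous_on G (\<lambda>x. LINT y:path_to x|\<Lambda>. h y)"
    by (simp add: gset_def f_def[abs_def])
qed

end

section \<open>Duality\<close>

text \<open>Young's inequality with the weight split as \<open>W powr (- 1 / q)\<close> and
  \<open>W powr (1 / q)\<close>: it cancels in the product and leaves \<open>W powr (1 - p)\<close>
  next to \<open>a\<close>, as \<open>- p / q = 1 - p\<close>. The scale \<open>K\<close> is left
  free to be optimized after summation.\<close>

lemma young_weighted:
  fixes a h K W p q :: real
  assumes p: "1 < p" and q: "q = p / (p - 1)" and K: "0 < K" and W: "0 < W"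
  shows "\<bar>a\<bar> * \<bar>h\<bar> \<le> K * (\<bar>a\<bar> powr p * W powr (1 - p) / (K powr p * p) + W * \<bar>h\<bar> powr q / q)"
proof -
  have q1: "1 < q" "1 / p + 1 / q = 1"
    using p by (auto simp: q field_simps)
  define x where "x = \<bar>a\<bar> * W powr (- 1 / q) / K"
  define y where "y = W powr (1 / q) * \<bar>h\<bar>"
  have "x * y \<le> x powr p / p + y powr q / q"
    using Youngs_inequality[OF p q1(1,2), of x y] K by (simp add: x_def y_def)
  moreover have "x * y = \<bar>a\<bar> * \<bar>h\<bar> / K"
    using W by (simp add: x_def y_def powr_minus divide_simps)
  moreover have "x powr p = \<bar>a\<bar> powr p * W powr (1 - p) / K powr p"
  proof -
    have "- p / q = 1 - p" using p by (simp add: q field_simps)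
    then show ?thesis
      using K by (simp add: x_def powr_divide powr_mult powr_powr)
  qed
  moreover have "y powr q = W * \<bar>h\<bar> powr q"
    using W q1 by (simp add: y_def powr_mult powr_powr)
  ultimately have "\<bar>a\<bar> * \<bar>h\<bar> / K \<le> \<bar>a\<bar> powr p * W powr (1 - p) / K powr p / p + W * \<bar>h\<bar> powr q / q"
    by simp
  then have "\<bar>a\<bar> * \<bar>h\<bar> \<le> (\<bar>a\<bar> powr p * W powr (1 - p) / K powr p / p + W * \<bar>h\<bar> powr q / q) * K"
    using K by (simp only: pos_divide_le_eq)
  then show ?thesis
    by (simp add: mult.commute)
qed

context unique_path_graph
begin

section \<open>Measures concentrated on the nodes\<close>

definition node_measure :: "'a measure \<Rightarrow> bool" where
  "node_measure \<mu> \<longleftrightarrow> prob_space \<mu> \<and> sets \<mu> = sets (restrict_space borel G) \<and> emeasure \<mu> (G - V) = 0"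

lemma integral_node_measure:
  fixes g :: "'a \<Rightarrow> real"
  assumes \<mu>: "node_measure \<mu>" and g [measurable]: "g \<in> borel_measurable \<mu>"
  shows "(\<integral>x. g x \<partial>\<mu>) = (\<Sum>v\<in>V. g v * measure \<mu> {v})"
proof -
  interpret prob_space \<mu> using \<mu> by (simp add: node_measure_def)
  have sets: "sets \<mu> = sets (restrict_space borel G)"
    using \<mu> by (simp add: node_measure_def)
  have space: "space \<mu> = G"
    using sets_eq_imp_space_eq[OF sets] by (simp add: space_restrict_space)
  have in_sets: "A \<in> sets \<mu>" if "A \<in> sets borel" "A \<subseteq> G" for A
    using that borel_G by (auto simp: sets sets_restrict_space image_iff)
  have [measurable]: "{v} \<in> sets \<mu>" if "v \<in> V" for v
    using that V_subset_G by (intro in_sets) auto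
  have "G - V \<in> null_sets \<mu>"
    using \<mu> finite_nodes by (intro null_setsI in_sets) (auto simp: node_measure_def finite_imp_closed)
  from AE_not_in[OF this] AE_space have "AE x in \<mu>. x \<in> V"
    by eventually_elim (auto simp: space)
  then have "(\<integral>x. g x \<partial>\<mu>) = (\<integral>x. (\<Sum>v\<in>V. g v * indicator {v} x) \<partial>\<mu>)"
  proof (intro integral_cong_AE, goal_cases)
    case 3
    then show ?case
    proof eventually_elim
      case (elim x)
      have "(\<Sum>v\<in>V. g v * indicator {v} x) = (\<Sum>v\<in>V. if v = x then g x else 0)"
        by (intro sum.cong) (auto simp: indicator_def)
      then show ?case using elim finite_nodes by simp
    qed
  qed measurable
  also have "\<dots> = (\<Sum>v\<in>V. g v * measure \<mu> {v})"
    by (subst Bochner_Integration.integral_sum)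
      (auto intro!: sum.cong simp: less_top[symmetric] space V_subset_G[THEN subsetD])
  finally show ?thesis .
qed

lemma measure_below:
  assumes \<mu>: "node_measure \<mu>" and e: "e \<in> E"
  shows "measure \<mu> (below e) = (\<Sum>v\<in>V. if edge_set e \<subseteq> path_to v then measure \<mu> {v} else 0)"
proof -
  have sets: "sets \<mu> = sets (restrict_space borel G)"
    using \<mu> by (simp add: node_measure_def)
  have sub: "below e \<subseteq> G" by (auto simp: gam_def)
  then have [measurable]: "below e \<in> sets \<mu>"
    using borel_below[OF e] by (auto simp: sets sets_restrict_space image_iff)
  have "measure \<mu> (below e) = (\<integral>x. indicator (below e) x \<partial>\<mu>)"
    using sub sets_eq_imp_space_eq[OF sets] by (simp add: space_restrict_space Int_absorb2)
  also have "\<dots> = (\<Sum>v\<in>V. indicator (below e) v * measure \<mu> {v})"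
    by (rule integral_node_measure[OF \<mu>]) measurable
  also have "\<dots> = (\<Sum>v\<in>V. if edge_set e \<subseteq> path_to v then measure \<mu> {v} else 0)"
    using node_in_G by (intro sum.cong) (auto simp: mem_below_iff indicator_def)
  finally show ?thesis .
qed

text \<open>An interchange of two finite sums: the mass at a node \<open>v\<close> is multiplied by
  the integral over \<open>e\<close> exactly when \<open>e\<close> lies on the path to
  \<open>v\<close>, that is, when \<open>v\<close> belongs to \<open>below e\<close>.\<close>

lemma duality:
  fixes f h :: "'a \<Rightarrow> real"
  assumes \<mu>: "node_measure \<mu>" and \<nu>: "node_measure \<nu>" and f: "continuous_on G f"
    and h: "h \<in> borel_measurable \<Lambda>" "\<And>e. e \<in> E \<Longrightarrow> set_integrable \<Lambda> (edge_int e) h"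
    and fh: "\<And>v. v \<in> V \<Longrightarrow> f v = (LINT y:path_to v|\<Lambda>. h y)"
  shows "(\<integral>x. f x \<partial>\<mu>) - (\<integral>x. f x \<partial>\<nu>)
    = (\<Sum>e\<in>E. (measure \<mu> (below e) - measure \<nu> (below e)) * (LINT y:edge_int e|\<Lambda>. h y))"
proof -
  define H where "H e = (LINT y:edge_int e|\<Lambda>. h y)" for e
  have *: "(\<integral>x. f x \<partial>\<rho>) = (\<Sum>e\<in>E. measure \<rho> (below e) * H e)" if \<rho>: "node_measure \<rho>" for \<rho>
  proof -
    have "f \<in> borel_measurable (restrict_space borel G)"
      using borel_measurable_continuous_on_restrict[OF f] .
    then have "f \<in> borel_measurable \<rho>"
      using \<rho> measurable_cong_sets[of \<rho> "restrict_space borel G" "borel :: real measure" borel]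
      by (simp add: node_measure_def)
    then have "(\<integral>x. f x \<partial>\<rho>) = (\<Sum>v\<in>V. f v * measure \<rho> {v})"
      by (rule integral_node_measure[OF \<rho>])
    also have "\<dots> = (\<Sum>v\<in>V. \<Sum>e\<in>E. (if edge_set e \<subseteq> path_to v then measure \<rho> {v} else 0) * H e)"
      using path_integral[OF _ h] fh
      by (intro sum.cong) (auto simp: H_def sum_distrib_right sum_distrib_left mult.commute intro!: sum.cong)
    also have "\<dots> = (\<Sum>e\<in>E. measure \<rho> (below e) * H e)"
      by (subst sum.swap) (simp add: measure_below[OF \<rho>] sum_distrib_right)
    finally show ?thesis .
  qed
  show ?thesis
    using *[OF \<mu>] *[OF \<nu>] by (simp add: H_def sum_subtractf left_diff_distrib)
qed

text \<open>For \<open>p > 1\<close>, integrating \<open>young_weighted\<close> over each edge and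
  adding up gives a bound that depends on the data only through \<open>C\<close> and the norm of
  \<open>h\<close>, for every scale \<open>K\<close>. For \<open>p = 1\<close> the weight enters
  with exponent 0 and a pointwise bound suffices.\<close>

lemma edge_integral_bound:
  fixes a :: "'a \<times> 'a \<Rightarrow> real"
  assumes p: "1 \<le> p" and h: "Lq_ball V E w z0 p h"
    and int: "\<And>e. e \<in> E \<Longrightarrow> set_integrable \<Lambda> (edge_int e) h"
  shows "\<bar>\<Sum>e\<in>E. a e * (LINT y:edge_int e|\<Lambda>. h y)\<bar>
    \<le> (\<Sum>e\<in>E. beta V E w z0 p e * \<bar>a e\<bar> powr p) powr (1 / p)"
proof -
  define C where "C = (\<Sum>e\<in>E. beta V E w z0 p e * \<bar>a e\<bar> powr p)"
  define S where "S = (\<Sum>e\<in>E. \<bar>a e\<bar> * (\<integral>x. indicator (edge_int e) x * \<bar>h x\<bar> \<partial>\<Lambda>))"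
  have "0 \<le> C"
    unfolding C_def using nn_integral_weight(2) by (intro sum_nonneg) auto
  have int_abs: "integrable \<Lambda> (\<lambda>x. indicator (edge_int e) x * \<bar>h x\<bar>)" if "e \<in> E" for e
    using integrable_abs[OF int[OF that, unfolded set_integrable_def]] by (simp add: abs_mult)
  have "\<bar>\<Sum>e\<in>E. a e * (LINT y:edge_int e|\<Lambda>. h y)\<bar> \<le> S"
    unfolding S_def
  proof (rule order_trans[OF sum_abs sum_mono])
    fix e
    have "\<bar>LINT y:edge_int e|\<Lambda>. h y\<bar> \<le> (\<integral>x. indicator (edge_int e) x * \<bar>h x\<bar> \<partial>\<Lambda>)"
      using integral_norm_bound[of \<Lambda> "\<lambda>x. indicator (edge_int e) x *\<^sub>R h x"]
      by (simp add: set_lebesgue_integral_def abs_mult)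
    then show "\<bar>a e * (LINT y:edge_int e|\<Lambda>. h y)\<bar> \<le> \<bar>a e\<bar> * (\<integral>x. indicator (edge_int e) x * \<bar>h x\<bar> \<partial>\<Lambda>)"
      by (simp add: abs_mult mult_left_mono)
  qed
  also have "S \<le> C powr (1 / p)"
  proof (cases "p = 1")
    case True
    have AE: "AE x in \<Lambda>. \<bar>h x\<bar> \<le> 1"
      using h True by (simp add: Lq_ball_def)
    have "(\<integral>x. indicator (edge_int e) x * \<bar>h x\<bar> \<partial>\<Lambda>) \<le> beta V E w z0 p e" if "e \<in> E" for e
      unfolding integral_weight[OF that, symmetric]
    proof (rule integral_mono_AE[OF int_abs[OF that] integrable_weight[OF that]])
      show "AE x in \<Lambda>. indicator (edge_int e) x * \<bar>h x\<bar> \<le> indicator (edge_int e) x * weight x powr (1 - p)"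
        using AE by eventually_elim (simp add: True indicator_def less_imp_neq[OF weight_pos, symmetric])
    qed
    then have "S \<le> C"
      unfolding S_def C_def True
      by (intro sum_mono) (simp add: mult_left_mono mult.commute)
    then show ?thesis using \<open>0 \<le> C\<close> True by simp
  next
    case False
    then have p1: "1 < p" using p by simp
    define q where "q = p / (p - 1)"
    have q: "0 < q" "1 / q = 1 - 1 / p" using p1 by (auto simp: q_def field_simps)
    have hq: "integrable \<Lambda> (\<lambda>x. weight x * \<bar>h x\<bar> powr q)"
      and ball: "(\<integral>x. weight x * \<bar>h x\<bar> powr q \<partial>\<Lambda>) powr (1 / q) \<le> 1"
      and [measurable]: "h \<in> borel_measurable \<Lambda>"
      using h False by (auto simp: Lq_ball_def Let_def q_def)
    define I where "I = (\<integral>x. weight x * \<bar>h x\<bar> powr q \<partial>\<Lambda>)"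
    have "0 \<le> I"
      unfolding I_def using weight_pos by (intro integral_nonneg_AE) (auto simp: less_imp_le)
    then have "I = (I powr (1 / q)) powr q"
      using q(1) by (simp only: powr_powr) simp
    also have "\<dots> \<le> 1 powr q"
      using ball q(1) by (intro powr_mono2) (auto simp: I_def)
    finally have "I \<le> 1" by simp
    have int_q: "integrable \<Lambda> (\<lambda>x. indicator (edge_int e) x * (weight x * \<bar>h x\<bar> powr q))" if "e \<in> E" for e
      using integrable_mult_indicator[OF _ hq, of "edge_int e"] by simp
    have I_sum: "(\<Sum>e\<in>E. \<integral>x. indicator (edge_int e) x * (weight x * \<bar>h x\<bar> powr q) \<partial>\<Lambda>) = I"
      unfolding I_def
    proof (subst Bochner_Integration.integral_sum[OF int_q, symmetric], assumption, rule integral_cong_AE)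
      show "AE x in \<Lambda>. (\<Sum>e\<in>E. indicator (edge_int e) x * (weight x * \<bar>h x\<bar> powr q)) = weight x * \<bar>h x\<bar> powr q"
        using AE_edge_int by eventually_elim (auto simp: sum_indicator_edge_int)
    qed (use int_q hq in auto)
    have S_le: "S \<le> K * (C / (K powr p * p) + 1 / q)" if K: "0 < K" for K
    proof -
      have "\<bar>a e\<bar> * (\<integral>x. indicator (edge_int e) x * \<bar>h x\<bar> \<partial>\<Lambda>)
        \<le> K * (beta V E w z0 p e * \<bar>a e\<bar> powr p / (K powr p * p)
              + (\<integral>x. indicator (edge_int e) x * (weight x * \<bar>h x\<bar> powr q) \<partial>\<Lambda>) / q)"
        (is "?l \<le> ?r") if e: "e \<in> E" for e
      proof -
        define g1 where "g1 = (\<lambda>x. indicator (edge_int e) x * weight x powr (1 - p))"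
        define g2 where "g2 = (\<lambda>x. indicator (edge_int e) x * (weight x * \<bar>h x\<bar> powr q))"
        have g: "integrable \<Lambda> g1" "integrable \<Lambda> g2"
          unfolding g1_def g2_def using integrable_weight[OF e] int_q[OF e] by auto
        have "?l = (\<integral>x. \<bar>a e\<bar> * (indicator (edge_int e) x * \<bar>h x\<bar>) \<partial>\<Lambda>)"
          by simp
        also have "\<dots> \<le> (\<integral>x. K * (\<bar>a e\<bar> powr p / (K powr p * p) * g1 x + g2 x / q) \<partial>\<Lambda>)"
        proof (rule integral_mono)
          fix x
          show "\<bar>a e\<bar> * (indicator (edge_int e) x * \<bar>h x\<bar>) \<le> K * (\<bar>a e\<bar> powr p / (K powr p * p) * g1 x + g2 x / q)"
            using young_weighted[OF p1 q_def K weight_pos[of x], of "a e" "h x"]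
            by (simp add: g1_def g2_def indicator_def)
        qed (use int_abs[OF e] g in auto)
        also have "\<dots> = ?r"
          using g integral_weight[OF e, of p] by (simp add: g1_def[symmetric] g2_def[symmetric])
        finally show ?thesis .
      qed
      then have "S \<le> (\<Sum>e\<in>E. K * (beta V E w z0 p e * \<bar>a e\<bar> powr p / (K powr p * p)
              + (\<integral>x. indicator (edge_int e) x * (weight x * \<bar>h x\<bar> powr q) \<partial>\<Lambda>) / q))"
        unfolding S_def by (rule sum_mono)
      also have "\<dots> = K * (C / (K powr p * p) + I / q)"
        by (simp add: sum_distrib_left[symmetric] sum.distrib sum_divide_distrib[symmetric] C_def I_sum)
      also have "\<dots> \<le> K * (C / (K powr p * p) + 1 / q)"
        using \<open>I \<le> 1\<close> q(1) K by (intro mult_left_mono add_left_mono divide_right_mono) auto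
      finally show ?thesis .
    qed
    \<comment> \<open>The optimal scale satisfies \<open>K powr p = C\<close>, which makes the
      bracket \<open>1 / p + 1 / q = 1\<close>. For \<open>C = 0\<close> it degenerates, and
      arbitrarily small \<open>K\<close> are used instead.\<close>
    show ?thesis
    proof (cases "C = 0")
      case True
      have "S \<le> 0 + \<epsilon>" if "0 < \<epsilon>" for \<epsilon>
        using S_le[of "\<epsilon> * q"] that q(1) True by simp
      then have "S \<le> 0" by (rule field_le_epsilon)
      then show ?thesis using True by simp
    next
      case False
      then have C: "0 < C" using \<open>0 \<le> C\<close> by simp
      have "S \<le> C powr (1 / p) * (C / ((C powr (1 / p)) powr p * p) + 1 / q)"
        using S_le[of "C powr (1 / p)"] C by simp
      also have "\<dots> = C powr (1 / p)"
        using C p1 q(2) by (simp add: powr_powr)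
      finally show ?thesis .
    qed
  qed
  finally show ?thesis by (simp add: C_def)
qed

text \<open>The equality case of Hoelder's inequality on each edge.\<close>
lemma extremal_derivative:
  fixes a :: "'a \<times> 'a \<Rightarrow> real"
  assumes p: "1 \<le> p"
  obtains h B where "Lq_ball V E w z0 p h" "h \<in> borel_measurable \<Lambda>" "\<And>x. \<bar>h x\<bar> \<le> B"
    and "(\<Sum>e\<in>E. a e * (LINT y:edge_int e|\<Lambda>. h y))
      = (\<Sum>e\<in>E. beta V E w z0 p e * \<bar>a e\<bar> powr p) powr (1 / p)"
proof -
  define C where "C = (\<Sum>e\<in>E. beta V E w z0 p e * \<bar>a e\<bar> powr p)"
  have "0 \<le> C"
    unfolding C_def using nn_integral_weight(2) by (intro sum_nonneg) auto
  \<comment> \<open>Solved from the equality case of Young's inequality at the scale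
    \<open>C powr (1 / p)\<close>. If \<open>C = 0\<close>, the convention
    \<open>0 powr x = 0\<close> makes every \<open>k e\<close> vanish, which is then the right
    choice.\<close>
  define k where "k e = C powr (- (p - 1) / p) * (sgn (a e) * \<bar>a e\<bar> powr (p - 1))" for e
  define h where "h x = (\<Sum>e\<in>E. indicator (edge_int e) x * (k e * weight x powr (1 - p)))" for x
  have h_edge: "h x = k e * weight x powr (1 - p)" if "e \<in> E" "x \<in> edge_int e" for e x
    using sum_indicator_edge_int[OF that, of "\<lambda>e. k e * weight x powr (1 - p)"] by (simp add: h_def)
  have h_out: "h x = 0" if "x \<notin> (\<Union>e\<in>E. edge_int e)" for x
    using that by (auto simp: h_def indicator_def intro!: sum.neutral)
  have "(\<lambda>x. \<Sum>e\<in>E. k e * (indicator (edge_int e) x * weight x powr (1 - p))) \<in> borel_measurable borel"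
    by (intro borel_measurable_sum borel_measurable_times borel_measurable_const measurable_weight_edge)
  then have h_meas: "h \<in> borel_measurable \<Lambda>"
    by (simp add: h_def[abs_def] mult.left_commute)
  have weight_le: "weight x powr (1 - p) \<le> 1" for x
    using powr_mono[of "1 - p" 0 "weight x"] weight_ge_1[of x] p by simp
  have h_le: "\<bar>h x\<bar> \<le> (\<Sum>e\<in>E. \<bar>k e\<bar>)" for x
    unfolding h_def
    by (rule order_trans[OF sum_abs sum_mono])
      (use weight_le[of x] in \<open>auto simp: indicator_def abs_mult mult_left_le\<close>)
  have edge: "(LINT y:edge_int e|\<Lambda>. h y) = k e * beta V E w z0 p e" if "e \<in> E" for e
  proof -
    have "(LINT y:edge_int e|\<Lambda>. h y) = (\<integral>y. k e * (indicator (edge_int e) y * weight y powr (1 - p)) \<partial>\<Lambda>)"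
      unfolding set_lebesgue_integral_def
      using h_edge[OF that] by (intro Bochner_Integration.integral_cong) (auto simp: indicator_def)
    then show ?thesis
      using integral_weight[OF that, of p] by simp
  qed
  have "a e * k e = C powr (- (p - 1) / p) * \<bar>a e\<bar> powr p" for e
  proof (cases "a e = 0")
    case False
    have "\<bar>a e\<bar> * \<bar>a e\<bar> powr (p - 1) = \<bar>a e\<bar> powr p"
      using False powr_add[of "\<bar>a e\<bar>" 1 "p - 1"] by simp
    moreover have "a e * sgn (a e) = \<bar>a e\<bar>"
      by (simp add: sgn_if abs_if)
    ultimately show ?thesis
      by (simp add: k_def mult.left_commute mult.assoc[symmetric])
  qed (use p in \<open>simp add: k_def\<close>)
  then have "(\<Sum>e\<in>E. a e * (LINT y:edge_int e|\<Lambda>. h y)) = C powr (- (p - 1) / p) * C"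
    by (simp add: edge C_def sum_distrib_left mult.assoc[symmetric])
      (simp add: mult.assoc mult.commute[of "beta _ _ _ _ _ _"])
  also have "\<dots> = C powr (1 / p)"
  proof (cases "C = 0")
    case False
    then have "C powr (- (p - 1) / p) * C = C powr (- (p - 1) / p + 1)"
      using \<open>0 \<le> C\<close> by (simp add: powr_add)
    also have "- (p - 1) / p + 1 = 1 / p"
      using p by (simp add: field_simps)
    finally show ?thesis .
  qed simp
  finally have attained: "(\<Sum>e\<in>E. a e * (LINT y:edge_int e|\<Lambda>. h y)) = C powr (1 / p)" .
  have ball: "Lq_ball V E w z0 p h"
  proof (cases "p = 1")
    case True
    \<comment> \<open>Both powers now have exponent 0, so each is 1, or 0 at base 0;
      \<open>k e\<close> is \<open>sgn (a e)\<close> or 0.\<close>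
    have "\<bar>k e\<bar> \<le> 1" for e
      using True by (auto simp: k_def abs_mult sgn_if)
    then have "\<bar>h x\<bar> \<le> 1" for x
      using h_edge[of _ x] h_out[of x] True weight_pos[of x] by (cases "x \<in> (\<Union>e\<in>E. edge_int e)") auto
    then show ?thesis
      using True h_meas by (simp add: Lq_ball_def)
  next
    case False
    then have p1: "1 < p" using p by simp
    define q where "q = p / (p - 1)"
    have q: "0 < q" "(p - 1) * q = p" "(1 - p) * q = - p"
      using p1 by (auto simp: q_def field_simps)
    have hq: "weight x * \<bar>h x\<bar> powr q
        = (\<Sum>e\<in>E. \<bar>k e\<bar> powr q * (indicator (edge_int e) x * weight x powr (1 - p)))" (is "?l = ?r") for x
    proof (cases "x \<in> (\<Union>e\<in>E. edge_int e)")
      case True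
      then obtain e where e: "e \<in> E" "x \<in> edge_int e" by blast
      have "weight x * \<bar>h x\<bar> powr q = \<bar>k e\<bar> powr q * (weight x * weight x powr (- p))"
        using h_edge[OF e] q weight_pos[of x] by (simp add: abs_mult powr_mult powr_powr)
      also have "weight x * weight x powr (- p) = weight x powr (1 - p)"
        using weight_pos[of x] powr_add[of "weight x" 1 "- p"] by simp
      also have "\<bar>k e\<bar> powr q * weight x powr (1 - p) = ?r"
        using sum_indicator_edge_int[OF e, of "\<lambda>e. \<bar>k e\<bar> powr q * weight x powr (1 - p)"]
        by (simp add: mult.left_commute)
      finally show ?thesis .
    next
      case False
      then show ?thesis using h_out[OF False] by (auto intro!: sum.neutral[symmetric])
    qed
    have int_hq: "integrable \<Lambda> (\<lambda>x. weight x * \<bar>h x\<bar> powr q)"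
      unfolding hq using integrable_weight
      by (intro Bochner_Integration.integrable_sum integrable_mult_right) auto
    have "(\<integral>x. weight x * \<bar>h x\<bar> powr q \<partial>\<Lambda>) = (\<Sum>e\<in>E. \<bar>k e\<bar> powr q * beta V E w z0 p e)"
      unfolding hq using integrable_weight integral_weight
      by (subst Bochner_Integration.integral_sum) auto
    \<comment> \<open>This is 1 in general but 0 for \<open>C = 0\<close>, so what follows uses only
      that it is at most 1.\<close>
    also have "\<dots> = C powr (- 1) * C"
    proof -
      have "\<bar>k e\<bar> powr q = C powr (- 1) * \<bar>a e\<bar> powr p" for e
      proof -
        have "- (p - 1) / p * q = - 1"
          using p1 by (simp add: q_def field_simps)
        then show ?thesis
          using q p1 by (cases "a e = 0") (auto simp: k_def abs_mult powr_mult powr_powr sgn_if)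
      qed
      then have "(\<Sum>e\<in>E. \<bar>k e\<bar> powr q * beta V E w z0 p e)
          = (\<Sum>e\<in>E. C powr (- 1) * (beta V E w z0 p e * \<bar>a e\<bar> powr p))"
        by (intro sum.cong) (simp_all only: ac_simps)
      then show ?thesis
        by (simp only: sum_distrib_left[symmetric] C_def[symmetric])
    qed
    finally have "(\<integral>x. weight x * \<bar>h x\<bar> powr q \<partial>\<Lambda>) \<le> 1" "0 \<le> (\<integral>x. weight x * \<bar>h x\<bar> powr q \<partial>\<Lambda>)"
      using \<open>0 \<le> C\<close> by (auto simp: powr_minus divide_simps)
    then have "(\<integral>x. weight x * \<bar>h x\<bar> powr q \<partial>\<Lambda>) powr (1 / q) \<le> 1"
      using q powr_mono2[of "1 / q" _ 1] by fastforce
    moreover have "integrable \<Lambda> (\<lambda>x. \<bar>h x\<bar> powr q)"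
    proof (rule Bochner_Integration.integrable_bound[OF int_hq])
      show "(\<lambda>x. \<bar>h x\<bar> powr q) \<in> borel_measurable \<Lambda>"
        using h_meas by measurable
      show "AE x in \<Lambda>. norm (\<bar>h x\<bar> powr q) \<le> norm (weight x * \<bar>h x\<bar> powr q)"
      proof (rule AE_I2)
        fix x
        have "1 * \<bar>h x\<bar> powr q \<le> weight x * \<bar>h x\<bar> powr q"
          using weight_ge_1 by (intro mult_right_mono) auto
        then show "norm (\<bar>h x\<bar> powr q) \<le> norm (weight x * \<bar>h x\<bar> powr q)"
          using weight_pos[of x] by (simp add: abs_mult)
      qed
    qed
    ultimately show ?thesis
      using False h_meas int_hq by (simp add: Lq_ball_def Let_def q_def[symmetric])
  qed
  show ?thesis
    using that[OF ball h_meas h_le] attained by (simp add: C_def)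
qed

text \<open>The supremum is a maximum: the path integral of the extremal derivative is feasible and
  attains the bound that holds for all feasible functions, so no separate argument for boundedness
  of the set is required.\<close>

lemma S_hat_eq:
  assumes p: "1 \<le> p" and \<mu>: "node_measure \<mu>" and \<nu>: "node_measure \<nu>"
  shows "S_hat V E w z0 p \<mu> \<nu> = (\<Sum>e\<in>E. beta V E w z0 p e *
    \<bar>measure \<mu> (below e) - measure \<nu> (below e)\<bar> powr p) powr (1 / p)"
  unfolding S_hat_def
proof (rule cSup_eq_maximum)
  define a where "a e = measure \<mu> (below e) - measure \<nu> (below e)" for e
  let ?C = "(\<Sum>e\<in>E. beta V E w z0 p e * \<bar>measure \<mu> (below e) - measure \<nu> (below e)\<bar> powr p)"
  obtain h B where h: "Lq_ball V E w z0 p h" "h \<in> borel_measurable \<Lambda>" "\<And>x. \<bar>h x\<bar> \<le> B"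
    and opt: "(\<Sum>e\<in>E. a e * (LINT y:edge_int e|\<Lambda>. h y)) = ?C powr (1 / p)"
    using extremal_derivative[OF p, of a] unfolding a_def by blast
  define f where "f x = (LINT y:path_to x|\<Lambda>. h y)" for x
  note int = continuous_path_integral(1)[OF h(2,3)]
  have cont: "continuous_on G f"
    using continuous_path_integral(2)[OF h(2,3)] by (simp add: f_def[abs_def])
  \<comment> \<open>Feasibility provides integrability along paths from the root. Each open edge
    lies on the path to its child, so integrability passes to it by restriction.\<close>
  have edge_int: "set_integrable \<Lambda> (edge_int e) h" if h: "\<And>x. x \<in> G \<Longrightarrow> set_integrable \<Lambda> (path_to x) h"
    and e: "e \<in> E" for h :: "'a \<Rightarrow> real" and e
  proof -
    obtain u v where d: "down e u v" using down_ex[OF e] .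
    then have "edge_int e \<subseteq> path_to v" "v \<in> G"
      using edge_int_subset[of e] joinsD(4)[OF downD(1)[OF d]] node_in_G unfolding down_def by blast+
    then show ?thesis
      using set_integrable_subset[OF h, of v "edge_int e"] by simp
  qed
  \<comment> \<open>The path to the root is the single point \<open>z0\<close> and contains no edge,
    so every term of the edge sum vanishes.\<close>
  have "f z0 = 0"
    using path_integral[OF z0 h(2) edge_int[OF int]] path_to_eqI[of z0 "{z0}"] z0_in_G
      measure_finite[of "{z0}"] edge_int_nonempty edge_int_subset z0
    by (force simp: f_def arcset_def gdist_def edge_int_def intro!: sum.neutral)
  then have "sob_feasible V E w z0 p f"
    unfolding sob_feasible_def using cont h(1) int by (auto simp: f_def)
  moreover have "(\<integral>x. f x \<partial>\<mu>) - (\<integral>x. f x \<partial>\<nu>) = ?C powr (1 / p)"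
    using duality[OF \<mu> \<nu> cont h(2) edge_int[OF int]] opt by (simp add: f_def a_def)
  ultimately show "?C powr (1 / p) \<in> {\<bar>(\<integral>x. f x \<partial>\<mu>) - (\<integral>x. f x \<partial>\<nu>)\<bar> | f. sob_feasible V E w z0 p f}"
    by (intro CollectI exI[of _ f]) simp
  fix y assume "y \<in> {\<bar>(\<integral>x. f x \<partial>\<mu>) - (\<integral>x. f x \<partial>\<nu>)\<bar> | f. sob_feasible V E w z0 p f}"
  then obtain f h where y: "y = \<bar>(\<integral>x. f x \<partial>\<mu>) - (\<integral>x. f x \<partial>\<nu>)\<bar>"
    and f: "continuous_on G f" "f z0 = 0" and h: "Lq_ball V E w z0 p h"
    and fh: "\<And>x. x \<in> G \<Longrightarrow> set_integrable \<Lambda> (path_to x) h \<and> f x - f z0 = (LINT y:path_to x|\<Lambda>. h y)"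
    by (auto simp: sob_feasible_def)
  have h_meas: "h \<in> borel_measurable \<Lambda>"
    using h by (simp add: Lq_ball_def)
  have int: "set_integrable \<Lambda> (edge_int e) h" if "e \<in> E" for e
    using edge_int[of h e] fh that by blast
  have "(\<integral>x. f x \<partial>\<mu>) - (\<integral>x. f x \<partial>\<nu>) = (\<Sum>e\<in>E. a e * (LINT y:edge_int e|\<Lambda>. h y))"
    unfolding a_def using fh f node_in_G by (intro duality[OF \<mu> \<nu> f(1) h_meas int]) auto
  then show "y \<le> ?C powr (1 / p)"
    using edge_integral_bound[OF p h int, of a] by (simp add: y a_def)
qed

end

theorem theorem3p5:
  fixes V :: "(real^'n) set" and E :: "((real^'n) \<times> (real^'n)) set"
    and w :: "(real^'n) \<times> (real^'n) \<Rightarrow> real" and z0 :: "real^'n"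
    and p :: real and \<mu> \<nu> :: "(real^'n) measure"
  assumes finV: "finite V"
    and E_sub: "E \<subseteq> V \<times> V"
    and E_loopfree: "\<forall>e\<in>E. fst e \<noteq> snd e"
    and E_undirected: "\<forall>e\<in>E. (snd e, fst e) \<notin> E"
    and w_pos: "\<forall>e\<in>E. w e > 0"
    and conn: "\<forall>u\<in>V. \<forall>v\<in>V. (u, v) \<in> (E \<union> E\<inverse>)\<^sup>*"
    and embed_nodes: "\<forall>e\<in>E. edge_set e \<inter> V = {fst e, snd e}"
    and embed_edges: "\<forall>e1\<in>E. \<forall>e2\<in>E. e1 \<noteq> e2 \<longrightarrow> edge_set e1 \<inter> edge_set e2 \<subseteq> V"
    and z0: "z0 \<in> V"
    and unique_sp: "\<forall>x\<in>gset V E. \<exists>!A. is_sp V E w z0 x A"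
    and p: "1 \<le> p"
    and \<mu>: "prob_space \<mu>" "sets \<mu> = sets (restrict_space borel (gset V E))"
           "emeasure \<mu> (gset V E - V) = 0"
    and \<nu>: "prob_space \<nu>" "sets \<nu> = sets (restrict_space borel (gset V E))"
           "emeasure \<nu> (gset V E - V) = 0"
  shows "S_hat V E w z0 p \<mu> \<nu> =
    (\<Sum>e\<in>E. beta V E w z0 p e *
        \<bar>measure \<mu> (gam V E w z0 e) - measure \<nu> (gam V E w z0 e)\<bar> powr p) powr (1 / p)"
proof -
  interpret unique_path_graph V E w z0
    by unfold_locales (use assms in auto)
  show ?thesis
    using p \<mu> \<nu> by (intro S_hat_eq) (simp_all add: node_measure_def)
qed

end
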